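(* Let $R$ be an associative ring with unit and let $M$ be a left unital $R$-module having property $AB5^{\ast}$ such that every small submodule of $M$ has Krull dimension. Then $\mathrm{Rad}(M)$ has Krull dimension.
   Context: Rings are associative with unit and modules are left unital. A submodule $N$ of a module $M$ is small in $M$, written $N \ll M$, if $N+K=M$ for a submodule $K\subseteq M$ implies $K=M$. $\mathrm{Rad}(M)$ denotes the sum of all small submodules of $M$. An $R$-module $M$ has property $AB5^{\ast}$ if for every submodule $N$ of $M$ and every inverse system $\{M_i\}_{i\in I}$ of submodules of $M$ (i.e. a nonempty family such that for all $i,j\in I$ there is $k\in I$ with $M_k\subseteq M_i\cap M_j$) one has $N+\bigcap_{i\in I}M_i=\bigcap_{i\in I}(N+M_i)$. Krull dimension of a module is meant in the usual (Gabriel–Rentschler, ordinal-valued) sense, i.e. the deviation of the lattice of submodules: the zero module has Krull dimension $-1$; for an ordinal $\alpha\ge 0$, $M$ has Krull dimension $\alpha$ if $M$ does not have Krull dimension $<\alpha$ and for every descending chain $M_1\supseteq M_2\supseteq\cdots$ of submodules, all but finitely many factors $M_i/M_{i+1}$ have Krull dimension $<\alpha$. A module "has Krull dimension" if it has Krull dimension $\alpha$ for some such $\alpha$ (including $-1$). *)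

theory Defs
  imports "HOL-Algebra.Algebra"
begin

section \<open>Left modules over arbitrary rings\<close>

text \<open>The library's \<^locale>\<open>module\<close> requires a commutative ring of scalars; the axioms below
  are the same, over an arbitrary ring with unit. The ring-multiplication fields \<^const>\<open>mult\<close> and
  \<^const>\<open>one\<close> of the module record play no role. The library's \<^locale>\<open>submodule\<close> does not
  mention commutativity and is used unchanged.\<close>

locale left_module = R?: ring R + M?: abelian_group M
  for R :: "('a, 'r) ring_scheme" (structure) and M :: "('a, 'b, 'm) module_scheme" (structure) +
  assumes smult_closed [simp, intro]:
      "\<lbrakk>a \<in> carrier R; x \<in> carrier M\<rbrakk> \<Longrightarrow> a \<odot>\<^bsub>M\<^esub> x \<in> carrier M"
    and smult_l_distr:
      "\<lbrakk>a \<in> carrier R; b \<in> carrier R; x \<in> carrier M\<rbrakk> \<Longrightarrow>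
        (a \<oplus> b) \<odot>\<^bsub>M\<^esub> x = a \<odot>\<^bsub>M\<^esub> x \<oplus>\<^bsub>M\<^esub> b \<odot>\<^bsub>M\<^esub> x"
    and smult_r_distr:
      "\<lbrakk>a \<in> carrier R; x \<in> carrier M; y \<in> carrier M\<rbrakk> \<Longrightarrow>
        a \<odot>\<^bsub>M\<^esub> (x \<oplus>\<^bsub>M\<^esub> y) = a \<odot>\<^bsub>M\<^esub> x \<oplus>\<^bsub>M\<^esub> a \<odot>\<^bsub>M\<^esub> y"
    and smult_assoc1:
      "\<lbrakk>a \<in> carrier R; b \<in> carrier R; x \<in> carrier M\<rbrakk> \<Longrightarrow>
        (a \<otimes> b) \<odot>\<^bsub>M\<^esub> x = a \<odot>\<^bsub>M\<^esub> (b \<odot>\<^bsub>M\<^esub> x)"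
    and smult_one [simp]:
      "x \<in> carrier M \<Longrightarrow> \<one> \<odot>\<^bsub>M\<^esub> x = x"

definition small_submodule ::
    "('a, 'r) ring_scheme \<Rightarrow> ('a, 'b, 'm) module_scheme \<Rightarrow> 'b set \<Rightarrow> bool" where
  "small_submodule R M N \<longleftrightarrow> submodule N R M \<and>
     (\<forall>K. submodule K R M \<longrightarrow> N <+>\<^bsub>M\<^esub> K = carrier M \<longrightarrow> K = carrier M)"

text \<open>The sum of a possibly infinite family of submodules: all finite sums of elements taken
  from members of the family.\<close>

definition sum_of_submodules :: "('a, 'b, 'm) module_scheme \<Rightarrow> 'b set set \<Rightarrow> 'b set" where
  "sum_of_submodules M \<N> =
     {finsum M x \<F> | x \<F>. finite \<F> \<and> \<F> \<subseteq> \<N> \<and> (\<forall>N \<in> \<F>. x N \<in> N)}"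

definition Rad :: "('a, 'r) ring_scheme \<Rightarrow> ('a, 'b, 'm) module_scheme \<Rightarrow> 'b set" where
  "Rad R M = sum_of_submodules M {N. small_submodule R M N}"

text \<open>Both sides of the equation depend only on the set of members of an inverse system, so the
  system is given as a set of submodules instead of an indexed family.\<close>

definition AB5_star :: "('a, 'r) ring_scheme \<Rightarrow> ('a, 'b, 'm) module_scheme \<Rightarrow> bool" where
  "AB5_star R M \<longleftrightarrow>
     (\<forall>N \<M>. submodule N R M \<longrightarrow> \<M> \<noteq> {} \<longrightarrow> (\<forall>L \<in> \<M>. submodule L R M) \<longrightarrow>
        (\<forall>L \<in> \<M>. \<forall>L' \<in> \<M>. \<exists>K \<in> \<M>. K \<subseteq> L \<inter> L') \<longrightarrow>
        N <+>\<^bsub>M\<^esub> \<Inter>\<M> = (\<Inter>L \<in> \<M>. N <+>\<^bsub>M\<^esub> L))"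

section \<open>Deviation and Krull dimension\<close>

text \<open>An ordinal is represented by a well-order \<open>\<alpha>\<close> and ordinals are compared by the library's
  \<open><o\<close>; the empty relation represents the ordinal 0. \<open>deviation P \<alpha> b a\<close> states that the interval
  from \<open>b\<close> to \<open>a\<close> in the subset \<open>P\<close> of the ambient order has deviation \<open>\<alpha> \<ge> 0\<close>; deviation \<open>-1\<close>
  is the case \<open>b = a\<close> and is treated separately. In the lattice of submodules, the interval from
  \<open>N\<close> to \<open>L\<close> is the lattice of submodules of the factor \<open>L/N\<close>.\<close>

context
  notes conj_cong [fundef_cong]
begin

function deviation :: "'p::order set \<Rightarrow> 'o rel \<Rightarrow> 'p \<Rightarrow> 'p \<Rightarrow> bool" where
  "deviation P \<alpha> b a \<longleftrightarrow>
     Well_order \<alpha> \<and>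
     \<not> (b = a \<or> (\<exists>\<beta>. \<beta> <o \<alpha> \<and> deviation P \<beta> b a)) \<and>
     (\<forall>c :: nat \<Rightarrow> 'p. (\<forall>i. c i \<in> P \<and> b \<le> c i \<and> c i \<le> a \<and> c (Suc i) \<le> c i) \<longrightarrow>
        finite {i. \<not> (c (Suc i) = c i \<or> (\<exists>\<beta>. \<beta> <o \<alpha> \<and> deviation P \<beta> (c (Suc i)) (c i)))})"
  by auto
termination
  by (relation "inv_image ordLess (\<lambda>(P, \<alpha>, b, a). \<alpha>)") (auto simp: wf_ordLess)

end

declare deviation.simps [simp del]

definition krull_dimension ::
    "('a, 'r) ring_scheme \<Rightarrow> ('a, 'b, 'm) module_scheme \<Rightarrow> 'o rel \<Rightarrow> bool" where
  "krull_dimension R M \<alpha> \<longleftrightarrow> deviation {N. submodule N R M} \<alpha> {\<zero>\<^bsub>M\<^esub>} (carrier M)"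

text \<open>The type of \<open>\<alpha>\<close> below bounds the cardinality of the available ordinals. This is no
  restriction: see \<open>has_krull_dimensionI\<close>.\<close>

definition has_krull_dimension ::
    "('a, 'r) ring_scheme \<Rightarrow> ('a, 'b, 'm) module_scheme \<Rightarrow> bool" where
  "has_krull_dimension R M \<longleftrightarrow>
     carrier M = {\<zero>\<^bsub>M\<^esub>} \<or> (\<exists>\<alpha> :: ('b set \<times> 'b set) set rel. krull_dimension R M \<alpha>)"

lemma deviation_unique:
  fixes \<alpha> \<beta> :: "'o rel"
  assumes \<alpha>: "deviation P \<alpha> b a" and \<beta>: "deviation P \<beta> b a"
  shows "\<alpha> =o \<beta>"
proof -
  note D = iffD1[OF deviation.simps]
  have "\<not> \<alpha> <o \<beta>" "\<not> \<beta> <o \<alpha>"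
    using D[OF \<beta>, THEN conjunct2, THEN conjunct1] D[OF \<alpha>, THEN conjunct2, THEN conjunct1] \<alpha> \<beta>
    by blast+
  with D[OF \<alpha>, THEN conjunct1] D[OF \<beta>, THEN conjunct1] show ?thesis
    using ordLess_or_ordLeq ordLeq_iff_ordLess_or_ordIso ordIso_symmetric by blast
qed

lemma deviation_universe:
  fixes P :: "'p::order set" and \<alpha> :: "'o rel"
  assumes "deviation P \<alpha> b a"
  shows "b = a \<or> (\<exists>\<beta> :: ('p \<times> 'p) set rel. deviation P \<beta> b a)"
proof -
  define \<kappa> :: "('p \<times> 'p) set rel" where "\<kappa> = |UNIV|"
  have \<kappa>: "Well_order \<kappa>" and F\<kappa>: "Field \<kappa> = UNIV"
    unfolding \<kappa>_def by (rule card_of_Well_order, rule Field_card_of)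
  then have wo: "wo_rel \<kappa>" by (simp add: wo_rel_def)
  define K where "K x = Restr \<kappa> (underS \<kappa> x)" for x
  have less: "K u <o K v" if uv: "u \<in> underS \<kappa> v" for u v
  proof -
    have "underS \<kappa> u \<subseteq> underS \<kappa> v"
      using uv underS_incr[OF wo_rel.TRANS[OF wo] wo_rel.ANTISYM[OF wo], of u v]
      by (simp add: underS_def)
    moreover have "u \<notin> underS \<kappa> u" by (simp add: underS_def)
    ultimately have "underS \<kappa> u \<subset> underS \<kappa> v" using uv by blast
    then show ?thesis
      unfolding K_def
      using ofilter_subset_ordLess[OF \<kappa>] wo_rel.underS_ofilter[OF wo] by blast
  qed
  have Kinj: "x = y" if iso: "K x =o K y" for x y
  proof (rule ccontr)
    assume "x \<noteq> y"
    moreover have "(x, y) \<in> \<kappa> \<or> (y, x) \<in> \<kappa>"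
      using wo_rel.TOTALS[OF wo] F\<kappa> by blast
    ultimately have "x \<in> underS \<kappa> y \<or> y \<in> underS \<kappa> x" by (auto simp: underS_def)
    then show False
      using less iso ordIso_symmetric[OF iso] not_ordLess_ordIso by blast
  qed
  have "\<exists>x. \<forall>b a. \<not> deviation P (K x) b a"
  proof (rule ccontr)
    assume "\<not> ?thesis"
    then have "\<forall>x. \<exists>y. deviation P (K x) (fst y) (snd y)" by simp
    then obtain g where g: "\<forall>x. deviation P (K x) (fst (g x)) (snd (g x))"
      by (rule choice[THEN exE])
    have "inj g"
    proof (rule injI)
      fix x y
      assume eq: "g x = g y"
      show "x = y"
        using deviation_unique[OF g[rule_format, of x] g[rule_format, of y, folded eq]] by (rule Kinj)
    qed
    from inj_imp_surj_inv[OF this] show False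
      using Cantors_theorem[of "UNIV :: ('p \<times> 'p) set"] unfolding Pow_UNIV by blast
  qed
  then obtain x where x: "\<And>b a. \<not> deviation P (K x) b a" by blast
  have woK: "Well_order (K x)"
    unfolding K_def by (rule Well_order_Restr[OF \<kappa>])
  have "b = a \<or> (\<exists>\<beta> :: ('p \<times> 'p) set rel. \<beta> <o K x \<and> deviation P \<beta> b a)"
    using assms
  proof (induction \<alpha> arbitrary: b a rule: wf_induct_rule[OF wf_ordLess])
    case (1 \<alpha>)
    note chains = iffD1[OF deviation.simps 1(2), THEN conjunct2, THEN conjunct2]
    have "finite {i. \<not> (c (Suc i) = c i \<or>
        (\<exists>\<beta> :: ('p \<times> 'p) set rel. \<beta> <o K x \<and> deviation P \<beta> (c (Suc i)) (c i)))}"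
      if c: "\<forall>i. c i \<in> P \<and> b \<le> c i \<and> c i \<le> a \<and> c (Suc i) \<le> c i" for c :: "nat \<Rightarrow> 'p"
    proof (rule finite_subset)
      show "finite {i. \<not> (c (Suc i) = c i \<or>
          (\<exists>\<beta> :: 'o rel. \<beta> <o \<alpha> \<and> deviation P \<beta> (c (Suc i)) (c i)))}"
        by (rule chains[THEN spec, THEN mp, OF c])
      show "{i. \<not> (c (Suc i) = c i \<or> (\<exists>\<beta> :: ('p \<times> 'p) set rel. \<beta> <o K x \<and> deviation P \<beta> (c (Suc i)) (c i)))}
          \<subseteq> {i. \<not> (c (Suc i) = c i \<or> (\<exists>\<beta> :: 'o rel. \<beta> <o \<alpha> \<and> deviation P \<beta> (c (Suc i)) (c i)))}"
        using 1(1) by (intro Collect_mono) metis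
    qed
    then show ?case
      using x[of b a] woK iffD2[OF deviation.simps[of P "K x" b a]] by blast
  qed
  then show ?thesis by blast
qed

lemma has_krull_dimensionI:
  fixes \<alpha> :: "'o rel"
  assumes "krull_dimension R M \<alpha>"
  shows "has_krull_dimension R M"
  using deviation_universe[OF assms[unfolded krull_dimension_def]]
  unfolding has_krull_dimension_def krull_dimension_def by (metis (full_types))

end

theory Submission
  imports Defs
begin

text \<open>A module has Krull dimension iff its lattice of submodules contains no densely ordered chain
  (Lemonnier), so the task is to show that a dense chain below \<open>J = Rad M\<close> produces a dense chain below
  some small submodule. Only three features of the lattice of submodules matter: it is complete, it
  is modular, and it satisfies \<open>AB5*\<close>. The main argument is therefore carried out in a
  modular \<open>AB5*\<close> lattice of sets with top \<open>T\<close> and bottom \<open>Z\<close>.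

  Call an interval dense if it contains a dense chain, and call \<open>V\<close> small over \<open>K\<close> if \<open>V/K\<close> is small in
  \<open>T/K\<close>. By \<open>AB5*\<close> and Zorn's lemma every \<open>K\<close> has a supplement \<open>C\<close>, a minimal element with \<open>K + C = T\<close>.
  If \<open>V\<close> is small over \<open>K\<close>, then \<open>V \<inter> C\<close> is small, and \<open>V/K\<close> is isomorphic to
  \<open>(V \<inter> C)/(K \<inter> C)\<close>. Hence no interval from \<open>K\<close> to an element small over \<open>K\<close> is dense
  (\<open>not_dense_interval_if_small_over\<close>): the hypothesis on small submodules passes to all factor modules.

  Now suppose that the interval below \<open>J\<close> is dense, and let \<open>K\<close> be a supplement of \<open>J\<close>. As \<open>J \<inter> K\<close> is
  small, \<open>J/(J \<inter> K)\<close> is dense and so is the isomorphic \<open>T/K\<close>. Whenever \<open>V/K\<close> is dense, \<open>V\<close> is not small over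
  \<open>K\<close>, and this gives a proper \<open>N \<supseteq> K\<close> with \<open>N + V = T\<close> for which \<open>(N \<inter> V)/K\<close> is still dense
  (\<open>dense_interval_shrink\<close>). Iteration yields proper elements \<open>N\<^sub>n \<supseteq> K\<close> and a decreasing sequence with
  \<open>N\<^sub>n + U\<^sub>n = T\<close> and \<open>U\<^sub>n\<^sub>+\<^sub>1 = N\<^sub>n \<inter> U\<^sub>n\<close>. Let \<open>B\<close> be the intersection of all \<open>U\<^sub>n\<close>, and \<open>E\<^sub>i\<close> that
  of \<open>U\<^sub>i\<close> and all \<open>N\<^sub>j\<close> with \<open>j > i\<close>. By \<open>AB5*\<close>, still \<open>N\<^sub>i + E\<^sub>i = T\<close>. As \<open>N\<^sub>i \<inter> E\<^sub>i = B\<close> and \<open>E\<^sub>i \<subseteq> N\<^sub>j\<close>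
  for \<open>j \<noteq> i\<close>, the \<open>E\<^sub>i/B\<close> form an infinite direct sum in \<open>T/B\<close>. As \<open>J + K = T\<close> and \<open>N\<^sub>i \<supseteq> K\<close> is
  proper, some small element is not below \<open>N\<^sub>i\<close>, and its projection to \<open>E\<^sub>i/B\<close> is a nonzero small
  \<open>L\<^sub>i/B\<close>. A second use of \<open>AB5*\<close> shows that even the infinite sum of the \<open>L\<^sub>i/B\<close> is small. But the
  sums over subsets of the index set form a copy of the power set of the natural numbers,
  which contains a chain ordered like the rationals: Dedekind cuts along an enumeration. So the
  interval from \<open>B\<close> to this sum is dense (\<open>coindependent_imp_dense_small_over\<close>), which contradicts the
  second paragraph.\<close>

section \<open>Dense intervals and deviation\<close>

text \<open>The relation \<open>W\<close> is a coinductive witness: every interval in it can be split in its interior into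
  two intervals in it. Repeated splitting yields a dense chain from \<open>b\<close> to \<open>a\<close>, and conversely the
  pairs \<open>x < y\<close> of a dense chain form such a \<open>W\<close>. This form avoids carrying chains through
  constructions; only a rule for splitting is ever needed.\<close>
definition dense_interval :: "'p::order set \<Rightarrow> 'p \<Rightarrow> 'p \<Rightarrow> bool" where
  "dense_interval P b a \<longleftrightarrow>
    (\<exists>W. W b a \<and> (\<forall>x y. W x y \<longrightarrow> (\<exists>z \<in> P. x < z \<and> z < y \<and> W x z \<and> W z y)))"

lemma dense_interval_coinduct:
  assumes "W b a"
    and "\<And>x y. W x y \<Longrightarrow> \<exists>z \<in> P. x < z \<and> z < y \<and> W x z \<and> W z y"
  shows "dense_interval P b a"
  unfolding dense_interval_def by (rule exI[of _ W]) (simp add: assms)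

lemma dense_intervalE:
  assumes "dense_interval P b a"
  obtains z where "z \<in> P" "b < z" "z < a" "dense_interval P b z" "dense_interval P z a"
proof -
  obtain W where W: "W b a" "\<And>x y. W x y \<Longrightarrow> \<exists>z \<in> P. x < z \<and> z < y \<and> W x z \<and> W z y"
    using assms unfolding dense_interval_def by blast
  then obtain z where "z \<in> P" "b < z" "z < a" "W b z" "W z a" by blast
  moreover have "dense_interval P x y" if "W x y" for x y
    using that W(2) by (rule dense_interval_coinduct)
  ultimately show thesis by (intro that)
qed

lemma dense_interval_less: "dense_interval P b a \<Longrightarrow> b < a"
  by (erule dense_intervalE) (rule less_trans)

lemma dense_interval_mono:
  assumes "dense_interval P b' a'" and "b \<le> b'" and "a' \<le> a"
  shows "dense_interval P b a"
proof (rule dense_interval_coinduct[where W = "\<lambda>x y. \<exists>x' y'. dense_interval P x' y' \<and> x \<le> x' \<and> y' \<le> y"])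
  show "\<exists>x' y'. dense_interval P x' y' \<and> b \<le> x' \<and> y' \<le> a"
    using assms by blast
next
  fix x y
  assume "\<exists>x' y'. dense_interval P x' y' \<and> x \<le> x' \<and> y' \<le> y"
  then obtain x' y' where xy: "dense_interval P x' y'" "x \<le> x'" "y' \<le> y" by blast
  from xy(1) obtain z where z: "z \<in> P" "x' < z" "z < y'" "dense_interval P x' z" "dense_interval P z y'"
    by (rule dense_intervalE)
  have "x < z" "z < y"
    using xy(2,3) z(2,3) by order+
  moreover have "\<exists>x' y'. dense_interval P x' y' \<and> x \<le> x' \<and> y' \<le> z"
    by (rule exI[of _ x'], rule exI[of _ z]) (simp add: z xy)
  moreover have "\<exists>x' y'. dense_interval P x' y' \<and> z \<le> x' \<and> y' \<le> y"
    by (rule exI[of _ z], rule exI[of _ y']) (simp add: z xy)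
  ultimately show "\<exists>z\<in>P. x < z \<and> z < y \<and> (\<exists>x' y'. dense_interval P x' y' \<and> x \<le> x' \<and> y' \<le> z)
      \<and> (\<exists>x' y'. dense_interval P x' y' \<and> z \<le> x' \<and> y' \<le> y)"
    using z(1) by blast
qed

text \<open>Strictness of \<open>g\<close> is only required on dense subintervals. In the proof of
  \<open>dense_interval_split\<close> this is all that is known.\<close>
lemma dense_interval_image:
  fixes g :: "'p::order \<Rightarrow> 'q::order"
  assumes "dense_interval P b a" and "b \<in> P" and "a \<in> P"
    and P: "\<And>x. \<lbrakk>x \<in> P; b \<le> x; x \<le> a\<rbrakk> \<Longrightarrow> g x \<in> Q"
    and less: "\<And>x y. \<lbrakk>x \<in> P; y \<in> P; b \<le> x; y \<le> a; x < y; dense_interval P x y\<rbrakk> \<Longrightarrow> g x < g y"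
  shows "dense_interval Q (g b) (g a)"
proof (rule dense_interval_coinduct[where W = "\<lambda>u v. \<exists>x y. u = g x \<and> v = g y \<and>
        x \<in> P \<and> y \<in> P \<and> b \<le> x \<and> y \<le> a \<and> dense_interval P x y"])
  show "\<exists>x y. g b = g x \<and> g a = g y \<and> x \<in> P \<and> y \<in> P \<and> b \<le> x \<and> y \<le> a \<and> dense_interval P x y"
    using assms(1-3) by blast
next
  fix u v
  assume "\<exists>x y. u = g x \<and> v = g y \<and> x \<in> P \<and> y \<in> P \<and> b \<le> x \<and> y \<le> a \<and> dense_interval P x y"
  then obtain x y where xy: "u = g x" "v = g y" "x \<in> P" "y \<in> P" "b \<le> x" "y \<le> a"
      "dense_interval P x y" by blast
  from xy(7) obtain z where z: "z \<in> P" "x < z" "z < y" "dense_interval P x z" "dense_interval P z y"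
    by (rule dense_intervalE)
  have bz: "b \<le> z" and za: "z \<le> a" using z xy by auto
  have "g z \<in> Q" using P[OF z(1) bz za] .
  moreover have "u < g z" unfolding xy(1) using less[OF xy(3) z(1) xy(5) za z(2) z(4)] .
  moreover have "g z < v" unfolding xy(2) using less[OF z(1) xy(4) bz xy(6) z(3) z(5)] .
  moreover have "\<exists>x y. u = g x \<and> g z = g y \<and> x \<in> P \<and> y \<in> P \<and> b \<le> x \<and> y \<le> a \<and> dense_interval P x y"
    by (rule exI[of _ x], rule exI[of _ z]) (simp add: xy z za)
  moreover have "\<exists>x y. g z = g x \<and> v = g y \<and> x \<in> P \<and> y \<in> P \<and> b \<le> x \<and> y \<le> a \<and> dense_interval P x y"
    by (rule exI[of _ z], rule exI[of _ y]) (simp add: xy z bz)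
  ultimately show "\<exists>w\<in>Q. u < w \<and> w < v
      \<and> (\<exists>x y. u = g x \<and> w = g y \<and> x \<in> P \<and> y \<in> P \<and> b \<le> x \<and> y \<le> a \<and> dense_interval P x y)
      \<and> (\<exists>x y. w = g x \<and> v = g y \<and> x \<in> P \<and> y \<in> P \<and> b \<le> x \<and> y \<le> a \<and> dense_interval P x y)"
    by (intro bexI[of _ "g z"] conjI)
qed

lemma dense_interval_rat_chain:
  fixes g :: "rat \<Rightarrow> 'p::order"
  assumes "\<And>q. g q \<in> P" and "strict_mono g" and "\<And>q. b \<le> g q" and "\<And>q. g q \<le> a"
  shows "dense_interval P b a"
proof -
  have "dense_interval (UNIV :: rat set) 0 1"
  proof (rule dense_interval_coinduct[where W = "(<)"])
    fix x y :: rat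
    assume "x < y"
    then show "\<exists>z\<in>UNIV. x < z \<and> z < y \<and> x < z \<and> z < y"
      using dense[of x y] by blast
  qed simp
  then have "dense_interval P (g 0) (g 1)"
    by (rule dense_interval_image[where g = g]) (use assms(1,2) in \<open>auto simp: strict_mono_def\<close>)
  then show ?thesis by (rule dense_interval_mono) (rule assms)+
qed

lemma deviation_chain:
  fixes P :: "'p::order set" and \<alpha> :: "'o rel"
  assumes "deviation P \<alpha> b a"
    and "\<forall>i. c i \<in> P \<and> b \<le> c i \<and> c i \<le> a \<and> c (Suc i) \<le> c i"
  shows "finite {i. \<not> (c (Suc i) = c i \<or> (\<exists>\<beta> :: 'o rel. \<beta> <o \<alpha> \<and> deviation P \<beta> (c (Suc i)) (c i)))}"
  by (rule iffD1[OF deviation.simps assms(1), THEN conjunct2, THEN conjunct2, THEN spec, THEN mp, OF assms(2)])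

lemma deviation_Well_order: "deviation P \<alpha> b a \<Longrightarrow> Well_order \<alpha>"
  by (drule iffD1[OF deviation.simps]) (rule conjunct1)

lemma deviation_neq: "deviation P \<alpha> b a \<Longrightarrow> b \<noteq> a"
  by (drule iffD1[OF deviation.simps]) blast

text \<open>By induction on the deviation: keep splitting off the upper part of a dense interval. All factors
  of the resulting descending chain are dense, hence none of them has smaller deviation.\<close>
lemma not_dense_interval_if_deviation:
  fixes P :: "'p::order set" and \<alpha> :: "'o rel"
  assumes "deviation P \<alpha> b a"
  shows "\<not> dense_interval P b a"
  using assms
proof (induction \<alpha> arbitrary: b a rule: wf_induct_rule[OF wf_ordLess])
  case (1 \<alpha>)
  show ?case
  proof
    assume dense: "dense_interval P b a"
    have "\<exists>c :: nat \<Rightarrow> 'p. \<forall>n. (c n \<le> a \<and> dense_interval P b (c n) \<and> (c n \<in> P))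
        \<and> (c (Suc n) < c n \<and> dense_interval P (c (Suc n)) (c n))"
    proof (rule dependent_nat_choice)
      from dense obtain z where "z \<in> P" "z < a" "dense_interval P b z"
        by (rule dense_intervalE)
      then show "\<exists>x. x \<le> a \<and> dense_interval P b x \<and> x \<in> P"
        by (intro exI[of _ z]) auto
    next
      fix x and n :: nat
      assume x: "x \<le> a \<and> dense_interval P b x \<and> x \<in> P"
      then obtain z where "z \<in> P" "z < x" "dense_interval P b z" "dense_interval P z x"
        using dense_intervalE[of P b x] by metis
      then show "\<exists>y. (y \<le> a \<and> dense_interval P b y \<and> y \<in> P) \<and> y < x \<and> dense_interval P y x"
        using x by (intro exI[of _ z]) auto
    qed
    then obtain c :: "nat \<Rightarrow> 'p" where c: "\<And>n. c n \<le> a" "\<And>n. dense_interval P b (c n)" "\<And>n. c n \<in> P"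
        "\<And>n. c (Suc n) < c n" "\<And>n. dense_interval P (c (Suc n)) (c n)" by blast
    have chain: "\<forall>i. c i \<in> P \<and> b \<le> c i \<and> c i \<le> a \<and> c (Suc i) \<le> c i"
      by (intro allI conjI c(1,3) less_imp_le[OF dense_interval_less[OF c(2)]] less_imp_le[OF c(4)])
    have "finite {i. \<not> (c (Suc i) = c i \<or> (\<exists>\<beta> :: 'o rel. \<beta> <o \<alpha> \<and> deviation P \<beta> (c (Suc i)) (c i)))}"
      by (rule deviation_chain[OF 1(2) chain])
    moreover have "{i. \<not> (c (Suc i) = c i \<or> (\<exists>\<beta> :: 'o rel. \<beta> <o \<alpha> \<and> deviation P \<beta> (c (Suc i)) (c i)))} = UNIV"
    proof -
      have "c (Suc i) \<noteq> c i" for i using c(4)[of i] by simp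
      moreover have "\<not> (\<beta> <o \<alpha> \<and> deviation P \<beta> (c (Suc i)) (c i))" for i and \<beta> :: "'o rel"
        using 1(1)[of \<beta>] c(5)[of i] by blast
      ultimately show ?thesis by auto
    qed
    ultimately show False by simp
  qed
qed

text \<open>Deviations do not depend on the type that supplies the ordinals, as long as it has enough of them:
  an ordinal below \<open>\<alpha>\<close> is isomorphic to an initial segment of \<open>\<alpha>\<close>.\<close>
lemma deviation_transfer:
  fixes P :: "'p::order set" and \<beta> :: "'o rel" and \<alpha> :: "'u rel"
  assumes "deviation P \<beta> b a" and "\<beta> <o \<alpha>"
  shows "\<exists>\<gamma> :: 'u rel. \<gamma> <o \<alpha> \<and> deviation P \<gamma> b a"
  using assms
proof (induction \<beta> arbitrary: b a \<alpha> rule: wf_induct_rule[OF wf_ordLess])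
  case (1 \<beta>)
  have wo: "Well_order \<alpha>" "Well_order \<beta>" using ordLess_Well_order_simp[OF 1(3)] by (simp_all only:)
  then obtain x where x: "\<beta> =o Restr \<alpha> (underS \<alpha> x)"
    using 1(3) ordLess_iff_ordIso_Restr by blast
  define \<beta>' where "\<beta>' = Restr \<alpha> (underS \<alpha> x)"
  have iso: "\<beta> =o \<beta>'" using x unfolding \<beta>'_def .
  have less: "\<beta>' <o \<alpha>" using iso 1(3) ordIso_ordLess_trans ordIso_symmetric by blast
  have step: "\<exists>\<gamma>' :: 'u rel. \<gamma>' <o \<beta>' \<and> deviation P \<gamma>' u v"
    if "\<gamma> <o \<beta>" "deviation P \<gamma> u v" for \<gamma> :: "'o rel" and u v
    using 1(1)[of \<gamma> u v \<beta>'] that ordLess_ordIso_trans[OF that(1) iso] by blast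
  show ?case
  proof (cases "\<exists>\<gamma> :: 'u rel. \<gamma> <o \<beta>' \<and> deviation P \<gamma> b a")
    case True
    then show ?thesis using less ordLess_transitive by blast
  next
    case False
    have "deviation P \<beta>' b a"
    proof (rule iffD2[OF deviation.simps], intro conjI allI impI)
      show "Well_order \<beta>'" using ordLess_Well_order_simp[OF less] by (rule conjunct1)
      show "\<not> (b = a \<or> (\<exists>\<gamma> :: 'u rel. \<gamma> <o \<beta>' \<and> deviation P \<gamma> b a))" using deviation_neq[OF 1(2)] False by blast
      fix c :: "nat \<Rightarrow> 'p"
      assume "\<forall>i. c i \<in> P \<and> b \<le> c i \<and> c i \<le> a \<and> c (Suc i) \<le> c i"
      from deviation_chain[OF 1(2) this] show "finite {i. \<not> (c (Suc i) = c i \<or> (\<exists>\<gamma> :: 'u rel. \<gamma> <o \<beta>' \<and> deviation P \<gamma> (c (Suc i)) (c i)))}"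
        by (rule rev_finite_subset) (use step in blast)
    qed
    then show ?thesis using less by blast
  qed
qed

lemma ordLess_card_of_set:
  fixes \<beta> :: "'o rel"
  assumes "Well_order \<beta>"
  shows "\<beta> <o |UNIV :: 'o set set|"
proof -
  have "|Field \<beta>| <o |UNIV :: 'o set set|"
    by (rule ordLeq_ordLess_trans[OF card_of_mono1[OF subset_UNIV]])
      (rule card_of_Pow[of "UNIV :: 'o set", unfolded Pow_UNIV])
  moreover have "|UNIV :: 'o set set| \<le>o |Field \<beta>|" if "|UNIV :: 'o set set| \<le>o \<beta>"
    using card_of_mono2[OF that] by (simp add: Field_card_of)
  ultimately show ?thesis
    using assms card_of_Well_order not_ordLess_ordLeq ordLess_or_ordLeq by blast
qed

text \<open>Density is witnessed by the relation that the interval from \<open>x\<close> to \<open>y\<close> has no deviation. Indeed,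
  suppose that for each \<open>z\<close> in between the interval below or the interval above \<open>z\<close> has a deviation.
  In a descending chain, either some member has a deviation towards \<open>x\<close>, and then so do all later
  factors, or every member has one towards \<open>y\<close>, and then so do all factors. In both cases almost
  all factors have a deviation, and the interval from \<open>x\<close> to \<open>y\<close> has one too.\<close>
lemma deviation_or_dense_interval:
  fixes P :: "'p::order set"
  assumes "b \<in> P" and "a \<in> P" and "b \<le> a"
  shows "b = a \<or> (\<exists>\<alpha> :: ('p \<times> 'p) set rel. deviation P \<alpha> b a) \<or> dense_interval P b a"
proof -
  \<comment> \<open>\<open>\<kappa>\<close> exceeds every ordinal that can be represented on the original type. It serves as a single
    strict bound for the deviations of all factors of a chain.\<close>
  define D where "D x y \<longleftrightarrow> x = y \<or> (\<exists>\<beta> :: ('p \<times> 'p) set rel. deviation P \<beta> x y)" for x y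
  define \<kappa> where "\<kappa> = |UNIV :: ('p \<times> 'p) set set set|"
  have D\<kappa>: "D x y \<longleftrightarrow> x = y \<or> (\<exists>\<beta> :: ('p \<times> 'p) set set rel. \<beta> <o \<kappa> \<and> deviation P \<beta> x y)" for x y
  proof
    assume "D x y"
    then consider "x = y" | \<beta> :: "('p \<times> 'p) set rel" where "deviation P \<beta> x y" unfolding D_def by blast
    then show "x = y \<or> (\<exists>\<beta> :: ('p \<times> 'p) set set rel. \<beta> <o \<kappa> \<and> deviation P \<beta> x y)"
    proof cases
      case (2 \<beta>)
      then have "\<beta> <o \<kappa>" unfolding \<kappa>_def using ordLess_card_of_set deviation_Well_order by blast
      then show ?thesis using deviation_transfer 2 by blast
    qed simp
  next
    assume "x = y \<or> (\<exists>\<beta> :: ('p \<times> 'p) set set rel. \<beta> <o \<kappa> \<and> deviation P \<beta> x y)"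
    then show "D x y" unfolding D_def using deviation_universe by blast
  qed
  have chains: "D x y" if fin: "\<And>c :: nat \<Rightarrow> 'p. \<forall>i. c i \<in> P \<and> x \<le> c i \<and> c i \<le> y \<and> c (Suc i) \<le> c i \<Longrightarrow>
      finite {i. \<not> D (c (Suc i)) (c i)}" for x y
  proof (rule ccontr)
    assume nD: "\<not> D x y"
    have "deviation P \<kappa> x y"
    proof (rule iffD2[OF deviation.simps], intro conjI allI impI)
      show "Well_order \<kappa>" unfolding \<kappa>_def by (rule card_of_Well_order)
      show "\<not> (x = y \<or> (\<exists>\<beta> :: ('p \<times> 'p) set set rel. \<beta> <o \<kappa> \<and> deviation P \<beta> x y))" using nD D\<kappa> by blast
    qed (use fin in \<open>simp add: D\<kappa>\<close>)
    then show False using nD deviation_universe unfolding D_def by blast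
  qed
  have sub: "D x y" if "D u v" "u \<le> x" "y \<le> v" "x \<in> P" "y \<in> P" "x \<le> y" for x y u v
  proof (cases "u = v")
    case True
    then show ?thesis using that unfolding D_def by (metis order.trans order_antisym)
  next
    case False
    with that(1) D\<kappa>[of u v] obtain \<beta> :: "('p \<times> 'p) set set rel" where \<beta>: "\<beta> <o \<kappa>" "deviation P \<beta> u v" by blast
    show ?thesis
    proof (rule chains)
      fix c :: "nat \<Rightarrow> 'p"
      assume "\<forall>i. c i \<in> P \<and> x \<le> c i \<and> c i \<le> y \<and> c (Suc i) \<le> c i"
      then have "\<forall>i. c i \<in> P \<and> u \<le> c i \<and> c i \<le> v \<and> c (Suc i) \<le> c i"
        using that by (meson order.trans)
      from deviation_chain[OF \<beta>(2) this] show "finite {i. \<not> D (c (Suc i)) (c i)}"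
        by (rule rev_finite_subset) (use \<beta>(1) ordLess_transitive D\<kappa> in blast)
    qed
  qed
  show ?thesis
  proof (cases "D b a")
    case True
    then show ?thesis unfolding D_def by blast
  next
    case False
    have "dense_interval P b a"
    proof (rule dense_interval_coinduct[where W = "\<lambda>x y. x \<in> P \<and> y \<in> P \<and> x \<le> y \<and> \<not> D x y"])
      show "b \<in> P \<and> a \<in> P \<and> b \<le> a \<and> \<not> D b a" using assms False by blast
    next
      fix x y
      assume xy: "x \<in> P \<and> y \<in> P \<and> x \<le> y \<and> \<not> D x y"
      have "\<exists>z\<in>P. x \<le> z \<and> z \<le> y \<and> \<not> D x z \<and> \<not> D z y"
      proof (rule ccontr)
        assume no: "\<not> ?thesis"
        have "D x y"
        proof (rule chains)
          fix c :: "nat \<Rightarrow> 'p"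
          assume c: "\<forall>i. c i \<in> P \<and> x \<le> c i \<and> c i \<le> y \<and> c (Suc i) \<le> c i"
          then have anti: "c j \<le> c i" if "i \<le> j" for i j
            using that by (meson decseq_Suc_iff decseqD)
          show "finite {i. \<not> D (c (Suc i)) (c i)}"
          proof (cases "\<exists>n. D x (c n)")
            case True
            then obtain n where n: "D x (c n)" by blast
            have "D (c (Suc i)) (c i)" if "n \<le> i" for i
              using sub[OF n, of "c (Suc i)" "c i"] c anti[OF that] by blast
            then have "{i. \<not> D (c (Suc i)) (c i)} \<subseteq> {..<n}" by (auto simp: not_le[symmetric])
            then show ?thesis using finite_subset by blast
          next
            case False
            then have "D (c (Suc i)) y" for i using no c by blast
            then have "D (c (Suc i)) (c i)" for i
              using sub[of "c (Suc i)" y "c (Suc i)" "c i"] c by blast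
            then show ?thesis by simp
          qed
        qed
        then show False using xy by blast
      qed
      then obtain z where z: "z \<in> P" "x \<le> z" "z \<le> y" "\<not> D x z" "\<not> D z y" by blast
      moreover have "x \<noteq> z" "z \<noteq> y" using z unfolding D_def by blast+
      ultimately show "\<exists>z\<in>P. x < z \<and> z < y \<and> (x \<in> P \<and> z \<in> P \<and> x \<le> z \<and> \<not> D x z)
          \<and> (z \<in> P \<and> y \<in> P \<and> z \<le> y \<and> \<not> D z y)"
        using xy by (intro bexI[of _ z]) auto
    qed
    then show ?thesis by blast
  qed
qed

section \<open>Modular lattices of sets with AB5*\<close>

text \<open>Submodules are sets ordered by inclusion with intersection as meet, so among the lattice
  operations only the join is a parameter. Modularity and \<open>AB5*\<close> are the two properties beyond completeness.\<close>
locale AB5_star_lattice =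
  fixes P :: "'p set set" and T Z :: "'p set" and join :: "'p set \<Rightarrow> 'p set \<Rightarrow> 'p set" (infixl "\<curlyvee>" 65)
  assumes top_in: "T \<in> P" and le_top: "x \<in> P \<Longrightarrow> x \<subseteq> T"
    and bot_in: "Z \<in> P" and bot_le: "x \<in> P \<Longrightarrow> Z \<subseteq> x"
    and Inter_in: "\<lbrakk>\<A> \<subseteq> P; \<A> \<noteq> {}\<rbrakk> \<Longrightarrow> \<Inter>\<A> \<in> P"
    and join_in: "\<lbrakk>x \<in> P; y \<in> P\<rbrakk> \<Longrightarrow> x \<curlyvee> y \<in> P"
    and join_ge1: "\<lbrakk>x \<in> P; y \<in> P\<rbrakk> \<Longrightarrow> x \<subseteq> x \<curlyvee> y"
    and join_ge2: "\<lbrakk>x \<in> P; y \<in> P\<rbrakk> \<Longrightarrow> y \<subseteq> x \<curlyvee> y"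
    and join_least: "\<lbrakk>x \<in> P; y \<in> P; z \<in> P; x \<subseteq> z; y \<subseteq> z\<rbrakk> \<Longrightarrow> x \<curlyvee> y \<subseteq> z"
    and modular_le: "\<lbrakk>x \<in> P; y \<in> P; z \<in> P; x \<subseteq> z\<rbrakk> \<Longrightarrow> (x \<curlyvee> y) \<inter> z \<subseteq> x \<curlyvee> (y \<inter> z)"
    and AB5_star: "\<lbrakk>x \<in> P; \<A> \<subseteq> P; \<A> \<noteq> {}; \<And>a b. \<lbrakk>a \<in> \<A>; b \<in> \<A>\<rbrakk> \<Longrightarrow> \<exists>c \<in> \<A>. c \<subseteq> a \<inter> b\<rbrakk>
        \<Longrightarrow> x \<curlyvee> \<Inter>\<A> = (\<Inter>a \<in> \<A>. x \<curlyvee> a)"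
begin

lemma Int_in: "\<lbrakk>x \<in> P; y \<in> P\<rbrakk> \<Longrightarrow> x \<inter> y \<in> P"
  using Inter_in[of "{x, y}"] by simp

lemma join_comm: "\<lbrakk>x \<in> P; y \<in> P\<rbrakk> \<Longrightarrow> x \<curlyvee> y = y \<curlyvee> x"
  by (intro equalityI join_least join_in join_ge1 join_ge2)

lemma join_mono: "\<lbrakk>x \<in> P; y \<in> P; x' \<in> P; y' \<in> P; x \<subseteq> x'; y \<subseteq> y'\<rbrakk> \<Longrightarrow> x \<curlyvee> y \<subseteq> x' \<curlyvee> y'"
  by (meson join_in join_ge1 join_ge2 join_least order_trans)

lemma join_absorb: "\<lbrakk>x \<in> P; y \<in> P; x \<subseteq> y\<rbrakk> \<Longrightarrow> x \<curlyvee> y = y"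
  by (intro equalityI join_least join_ge2) simp_all

lemma join_assoc:
  assumes x: "x \<in> P" and y: "y \<in> P" and z: "z \<in> P"
  shows "(x \<curlyvee> y) \<curlyvee> z = x \<curlyvee> (y \<curlyvee> z)"
proof (intro equalityI)
  note xy = join_in[OF x y] and yz = join_in[OF y z]
  show "(x \<curlyvee> y) \<curlyvee> z \<subseteq> x \<curlyvee> (y \<curlyvee> z)"
    by (intro join_least x y z xy yz join_in join_ge1 order_trans[OF _ join_ge2[OF x yz]] join_ge2)
  show "x \<curlyvee> (y \<curlyvee> z) \<subseteq> (x \<curlyvee> y) \<curlyvee> z"
    by (intro join_least x y z xy yz join_in join_ge2 order_trans[OF _ join_ge1[OF xy z]] join_ge1)
qed

lemma modular: "\<lbrakk>x \<in> P; y \<in> P; z \<in> P; x \<subseteq> z\<rbrakk> \<Longrightarrow> (x \<curlyvee> y) \<inter> z = x \<curlyvee> (y \<inter> z)"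
  by (intro equalityI modular_le Int_greatest join_least join_mono join_in Int_in) auto

lemma join_topI: "\<lbrakk>x \<in> P; y \<in> P; T \<subseteq> x \<curlyvee> y\<rbrakk> \<Longrightarrow> x \<curlyvee> y = T"
  by (intro equalityI le_top join_in)

lemma join_top_mono:
  assumes "x \<curlyvee> y = T" and "x \<in> P" "y \<in> P" "x' \<in> P" "y' \<in> P" "x \<subseteq> x'" "y \<subseteq> y'"
  shows "x' \<curlyvee> y' = T"
  using join_mono[OF assms(2-7)] assms(1,4,5) by (intro join_topI) simp_all

lemma AB5_star_decreasing:
  fixes V :: "nat \<Rightarrow> 'p set"
  assumes y: "y \<in> P" and V: "\<And>n. V n \<in> P" and dec: "\<And>n. V (Suc n) \<subseteq> V n"
    and top: "\<And>n. y \<curlyvee> V n = T"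
  shows "y \<curlyvee> \<Inter>(range V) = T"
proof -
  have anti: "V n \<subseteq> V m" if "m \<le> n" for m n
    using that by (induction rule: dec_induct) (use dec in blast)+
  have "y \<curlyvee> \<Inter>(range V) = (\<Inter>a \<in> range V. y \<curlyvee> a)"
  proof (rule AB5_star[OF y])
    fix a b
    assume "a \<in> range V" "b \<in> range V"
    then obtain m n where "a = V m" "b = V n" by blast
    then have "V (max m n) \<subseteq> a \<inter> b"
      using anti[of m "max m n"] anti[of n "max m n"] by simp
    then show "\<exists>c\<in>range V. c \<subseteq> a \<inter> b" by blast
  qed (use V in auto)
  then show ?thesis using top by simp
qed

text \<open>Intersection with \<open>C\<close> is the isomorphism from \<open>(A + C)/A\<close> onto \<open>C/(A \<inter> C)\<close>, with inverse
  \<open>u \<mapsto> A + u\<close>.\<close>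
lemma dense_interval_Int:
  assumes ac: "A \<in> P" "C \<in> P" and top: "A \<curlyvee> C = T"
    and x: "x \<in> P" "y \<in> P" "A \<subseteq> x" and dense: "dense_interval P x y"
  shows "dense_interval P (x \<inter> C) (y \<inter> C)"
  using dense x(1,2)
proof (rule dense_interval_image[where g = "\<lambda>x. x \<inter> C"])
  fix u v
  assume uv: "u \<in> P" "v \<in> P" "x \<subseteq> u" "u \<subset> v"
  have eq: "w = A \<curlyvee> (C \<inter> w)" if "w \<in> P" "A \<subseteq> w" for w
    using modular[of A C w] that ac top le_top[of w] by (simp add: Int_absorb1)
  have "u \<inter> C \<noteq> v \<inter> C"
    using eq[of u] eq[of v] uv x(3) by (metis Int_commute order_trans psubset_imp_subset psubset_eq)
  then show "u \<inter> C \<subset> v \<inter> C" using uv(4) by blast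
qed (use ac in \<open>auto intro: Int_in\<close>)

text \<open>The class of modules without dense chains is closed under extensions. By modularity, a strict
  inclusion \<open>u \<subset> v\<close> stays strict after intersecting with \<open>h\<close> or after adding \<open>h\<close>. If intersecting identifies
  the ends of some dense subinterval, then adding \<open>h\<close> is injective on it; otherwise intersecting
  is strict on all dense subintervals.\<close>
lemma dense_interval_split:
  assumes in_P: "x \<in> P" "h \<in> P" "y \<in> P" and le: "x \<subseteq> h" "h \<subseteq> y" and dense: "dense_interval P x y"
  shows "dense_interval P x h \<or> dense_interval P h y"
proof (cases "\<exists>u v. u \<in> P \<and> v \<in> P \<and> x \<subseteq> u \<and> v \<subseteq> y \<and> dense_interval P u v \<and> u \<inter> h = v \<inter> h")
  case True
  then obtain u v where uv: "u \<in> P" "v \<in> P" "x \<subseteq> u" "v \<subseteq> y" "dense_interval P u v" "u \<inter> h = v \<inter> h"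
    by blast
  have "dense_interval P (h \<curlyvee> u) (h \<curlyvee> v)"
    using uv(5,1,2)
  proof (rule dense_interval_image[where g = "\<lambda>x. h \<curlyvee> x"])
    fix s t
    assume st: "s \<in> P" "t \<in> P" "u \<subseteq> s" "t \<subseteq> v" "s \<subset> t"
    have eq: "s \<inter> h = t \<inter> h" using st uv(6) by blast
    have "h \<curlyvee> s \<noteq> h \<curlyvee> t"
    proof
      assume same: "h \<curlyvee> s = h \<curlyvee> t"
      have "t = (s \<curlyvee> h) \<inter> t"
        using same join_ge2[OF in_P(2) st(2)] join_comm[OF st(1) in_P(2)] by blast
      also have "\<dots> = s \<curlyvee> (h \<inter> t)" using st in_P by (intro modular) auto
      also have "\<dots> \<subseteq> s" using eq st in_P by (intro join_least Int_in) auto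
      finally show False using st(5) by blast
    qed
    moreover have "h \<curlyvee> s \<subseteq> h \<curlyvee> t" using st in_P by (intro join_mono) auto
    ultimately show "h \<curlyvee> s \<subset> h \<curlyvee> t" by blast
  qed (use in_P in \<open>auto intro: join_in\<close>)
  then have "dense_interval P h y"
    by (rule dense_interval_mono[OF _ join_ge1[OF in_P(2) uv(1)] join_least[OF in_P(2) uv(2) in_P(3) le(2) uv(4)]])
  then show ?thesis ..
next
  case False
  have "dense_interval P (x \<inter> h) (y \<inter> h)"
    using dense in_P(1,3)
  proof (rule dense_interval_image[where g = "\<lambda>x. x \<inter> h"])
    fix u v
    assume uv: "u \<in> P" "v \<in> P" "x \<subseteq> u" "v \<subseteq> y" "u \<subset> v" "dense_interval P u v"
    then have "u \<inter> h \<noteq> v \<inter> h" using False by blast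
    then show "u \<inter> h \<subset> v \<inter> h" using uv(5) by blast
  qed (use in_P in \<open>auto intro: Int_in\<close>)
  then have "dense_interval P x h"
    by (rule dense_interval_mono) (use le in auto)
  then show ?thesis ..
qed

section \<open>Supplements and relatively small elements\<close>

text \<open>In module terms, \<open>(K + V)/K\<close> is small in \<open>T/K\<close>. For \<open>K = Z\<close> this is smallness of \<open>V\<close> itself.\<close>
definition small_over :: "'p set \<Rightarrow> 'p set \<Rightarrow> bool" where
  "small_over K V \<longleftrightarrow> V \<in> P \<and> (\<forall>Y \<in> P. K \<subseteq> Y \<longrightarrow> V \<curlyvee> Y = T \<longrightarrow> Y = T)"

abbreviation small :: "'p set \<Rightarrow> bool" where
  "small \<equiv> small_over Z"

definition supplement :: "'p set \<Rightarrow> 'p set \<Rightarrow> bool" where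
  "supplement A C \<longleftrightarrow> C \<in> P \<and> A \<curlyvee> C = T \<and> (\<forall>Y \<in> P. Y \<subseteq> C \<longrightarrow> A \<curlyvee> Y = T \<longrightarrow> Y = C)"

text \<open>Zorn's lemma applies downwards: \<open>AB5*\<close> says that the intersection of a chain of elements \<open>C\<close> with
  \<open>A + C = T\<close> again has this property.\<close>
lemma supplement_exists:
  assumes A: "A \<in> P"
  shows "\<exists>C. supplement A C"
proof -
  define S where "S = {C \<in> P. A \<curlyvee> C = T}"
  let ?r = "relation_of (\<lambda>x y. y \<subseteq> x) S"
  have "\<exists>m\<in>S. \<forall>a\<in>S. a \<subseteq> m \<longrightarrow> a = m"
  proof (rule predicate_Zorn)
    show "partial_order_on S ?r"
      by (rule partial_order_on_relation_ofI) auto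
  next
    fix \<C>
    assume chain: "\<C> \<in> Chains ?r"
    then have S: "\<C> \<subseteq> S" by (auto simp: Chains_def relation_of_def)
    show "\<exists>u\<in>S. \<forall>a\<in>\<C>. u \<subseteq> a"
    proof (cases "\<C> = {}")
      case True
      have "T \<in> S" unfolding S_def by (simp add: top_in join_absorb le_top A)
      then show ?thesis using True by blast
    next
      case False
      have sub: "\<C> \<subseteq> P" using S unfolding S_def by blast
      have "A \<curlyvee> \<Inter>\<C> = (\<Inter>c \<in> \<C>. A \<curlyvee> c)"
      proof (rule AB5_star[OF A sub False])
        fix a b
        assume ab: "a \<in> \<C>" "b \<in> \<C>"
        then have "a \<subseteq> b \<or> b \<subseteq> a" using chain by (auto simp: Chains_def relation_of_def)
        then show "\<exists>c\<in>\<C>. c \<subseteq> a \<inter> b" using ab by blast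
      qed
      also have "\<dots> = T" using S False unfolding S_def by auto
      finally have "\<Inter>\<C> \<in> S" unfolding S_def using Inter_in[OF sub False] by simp
      then show ?thesis by blast
    qed
  qed
  then obtain C where C: "C \<in> S" "\<And>Y. \<lbrakk>Y \<in> S; Y \<subseteq> C\<rbrakk> \<Longrightarrow> Y = C" by blast
  then show ?thesis unfolding supplement_def S_def by blast
qed

lemma small_bot: "small Z"
  unfolding small_over_def using bot_in bot_le join_absorb by auto

lemma small_join:
  assumes V: "small_over K V" and Y: "small_over K Y"
  shows "small_over K (V \<curlyvee> Y)"
  unfolding small_over_def
proof (intro conjI ballI impI)
  have in_P: "V \<in> P" "Y \<in> P" using V Y unfolding small_over_def by auto
  then show "V \<curlyvee> Y \<in> P" by (rule join_in)
  fix W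
  assume W: "W \<in> P" "K \<subseteq> W" "V \<curlyvee> Y \<curlyvee> W = T"
  then have "V \<curlyvee> (Y \<curlyvee> W) = T" using join_assoc in_P by simp
  moreover have "K \<subseteq> Y \<curlyvee> W" using W in_P join_ge2 by blast
  ultimately have "Y \<curlyvee> W = T" using V W in_P join_in unfolding small_over_def by blast
  then show "W = T" using Y W unfolding small_over_def by blast
qed

text \<open>If \<open>(V \<inter> C) + Y = T\<close>, then \<open>C = (V \<inter> C) + (Y \<inter> C)\<close> by modularity, so \<open>V + K + (Y \<inter> C) = T\<close>. Smallness
  over \<open>K\<close> removes \<open>V\<close>, and minimality of \<open>C\<close> then forces \<open>C \<subseteq> Y\<close>.\<close>
lemma small_Int_supplement:
  assumes K: "K \<in> P" and C: "supplement K C" and V: "small_over K V"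
  shows "small (V \<inter> C)"
  unfolding small_over_def
proof (intro conjI ballI impI)
  have in_P: "C \<in> P" "V \<in> P" and top: "K \<curlyvee> C = T"
    using C V unfolding supplement_def small_over_def by auto
  have XC: "V \<inter> C \<in> P" using in_P by (intro Int_in)
  show "V \<inter> C \<in> P" by (rule XC)
  fix Y
  assume Y: "Y \<in> P" "V \<inter> C \<curlyvee> Y = T"
  define W where "W = Y \<inter> C"
  have W: "W \<in> P" unfolding W_def using Y in_P by (intro Int_in)
  have KW: "K \<curlyvee> W \<in> P" using K W by (rule join_in)
  have XKW: "V \<curlyvee> (K \<curlyvee> W) \<in> P" using in_P(2) KW by (rule join_in)
  have "C = (V \<inter> C \<curlyvee> Y) \<inter> C" using Y(2) le_top[OF in_P(1)] by blast
  also have "\<dots> = V \<inter> C \<curlyvee> W" unfolding W_def using XC Y in_P by (intro modular) auto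
  also have "\<dots> \<subseteq> V \<curlyvee> (K \<curlyvee> W)"
    by (rule join_mono[OF XC W in_P(2) KW _ join_ge2[OF K W]]) blast
  finally have "C \<subseteq> V \<curlyvee> (K \<curlyvee> W)" .
  moreover have "K \<subseteq> V \<curlyvee> (K \<curlyvee> W)"
    using join_ge1[OF K W] join_ge2[OF in_P(2) KW] by blast
  ultimately have "T \<subseteq> V \<curlyvee> (K \<curlyvee> W)"
    using join_least[OF K in_P(1) XKW] top by blast
  then have "V \<curlyvee> (K \<curlyvee> W) = T" by (rule join_topI[OF in_P(2) KW])
  then have "K \<curlyvee> W = T" using V KW join_ge1[OF K W] unfolding small_over_def by blast
  then have "W = C" using C W unfolding supplement_def W_def by blast
  then have "V \<inter> C \<subseteq> Y" unfolding W_def by blast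
  then show "Y = T" using join_absorb[OF XC Y(1)] Y(2) by simp
qed

text \<open>The hypothesis on small elements is inherited by factors: a supplement \<open>C\<close> of \<open>K\<close> carries \<open>V/K\<close>
  to a factor of the small element \<open>V \<inter> C\<close>.\<close>
lemma not_dense_interval_if_small_over:
  assumes small: "\<And>S. small S \<Longrightarrow> \<not> dense_interval P Z S"
    and K: "K \<in> P" and V: "small_over K V" and KV: "K \<subseteq> V"
  shows "\<not> dense_interval P K V"
proof
  assume dense: "dense_interval P K V"
  obtain C where C: "supplement K C" using supplement_exists[OF K] ..
  then have C_in: "C \<in> P" and top: "K \<curlyvee> C = T" unfolding supplement_def by auto
  have V_in: "V \<in> P" using V unfolding small_over_def by blast
  have "dense_interval P (K \<inter> C) (V \<inter> C)"
    by (rule dense_interval_Int[OF K C_in top K V_in subset_refl dense])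
  then have "dense_interval P Z (V \<inter> C)"
    by (rule dense_interval_mono) (use bot_le[OF K] bot_le[OF C_in] in auto)
  then show False using small[OF small_Int_supplement[OF K C V]] by blast
qed

text \<open>As \<open>V\<close> is not small over \<open>K\<close>, there is a proper \<open>N\<close> above \<open>K\<close> with \<open>N + V = T\<close>. If \<open>(N \<inter> V)/K\<close> is not dense, then
  \<open>V/(N \<inter> V)\<close> is, and \<open>N\<close> can be enlarged by the midpoint \<open>c\<close> of a splitting of that interval.\<close>
lemma dense_interval_shrink:
  assumes small: "\<And>S. small S \<Longrightarrow> \<not> dense_interval P Z S"
    and K: "K \<in> P" and V: "V \<in> P" and KV: "K \<subseteq> V" and dense: "dense_interval P K V"
  shows "\<exists>N\<in>P. K \<subseteq> N \<and> N \<noteq> T \<and> N \<curlyvee> V = T \<and> dense_interval P K (N \<inter> V)"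
proof -
  have "\<not> small_over K V"
    using not_dense_interval_if_small_over[OF small K _ KV] dense by blast
  then obtain N where N: "N \<in> P" "K \<subseteq> N" "V \<curlyvee> N = T" "N \<noteq> T"
    using V unfolding small_over_def by blast
  have NV: "N \<inter> V \<in> P" using N(1) V by (rule Int_in)
  have K_NV: "K \<subseteq> N \<inter> V" using N(2) KV by blast
  have "dense_interval P K (N \<inter> V) \<or> dense_interval P (N \<inter> V) V"
    by (rule dense_interval_split[OF K NV V K_NV Int_lower2 dense])
  then show ?thesis
  proof
    assume "dense_interval P K (N \<inter> V)"
    then show ?thesis using N join_comm[OF V N(1)] by auto
  next
    assume "dense_interval P (N \<inter> V) V"
    then obtain c where c: "c \<in> P" "N \<inter> V \<subset> c" "c \<subset> V" "dense_interval P (N \<inter> V) c"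
      by (rule dense_intervalE)
    have cN: "c \<curlyvee> N \<in> P" using c(1) N(1) by (rule join_in)
    have "(c \<curlyvee> N) \<inter> V = c \<curlyvee> (N \<inter> V)"
      using c N V by (intro modular) auto
    also have "\<dots> = (N \<inter> V) \<curlyvee> c" using c(1) NV by (rule join_comm)
    also have "\<dots> = c" using NV c by (intro join_absorb) auto
    finally have cV: "(c \<curlyvee> N) \<inter> V = c" .
    have "c \<curlyvee> N \<noteq> T" using cV c(3) le_top[OF V] by blast
    moreover have "(c \<curlyvee> N) \<curlyvee> V = T"
      using join_top_mono[OF _ N(1) V cN V join_ge2[OF c(1) N(1)] subset_refl] N(3)
        join_comm[OF V N(1)] by simp
    moreover have "K \<subseteq> c \<curlyvee> N" using N(2) join_ge2[OF c(1) N(1)] by blast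
    moreover have "dense_interval P K ((c \<curlyvee> N) \<inter> V)"
      unfolding cV using c(4) K_NV order_refl by (rule dense_interval_mono)
    ultimately show ?thesis using cN by blast
  qed
qed

section \<open>Coindependent sequences\<close>

text \<open>The sequence is coindependent because \<open>U i\<close> lies in the meet of all earlier members. The witness
  \<open>E\<close> is the meet of \<open>U i\<close> with all later members. The finite stages \<open>F m\<close> satisfy \<open>N i + F m = T\<close> by modularity, and \<open>AB5*\<close>
  passes to the limit.\<close>
lemma coindependent_complement:
  fixes N U :: "nat \<Rightarrow> 'p set"
  assumes N: "\<And>n. N n \<in> P" and U: "\<And>n. U n \<in> P"
    and top: "\<And>n. N n \<curlyvee> U n = T" and Suc: "\<And>n. U (Suc n) = N n \<inter> U n"
  shows "\<exists>E\<in>P. N i \<curlyvee> E = T \<and> N i \<inter> E = \<Inter>(range U) \<and> (\<forall>j. j \<noteq> i \<longrightarrow> E \<subseteq> N j) \<and> E \<subseteq> U i"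
proof -
  have anti: "U n \<subseteq> U m" if "m \<le> n" for m n
    using that by (induction rule: dec_induct) (use Suc in auto)
  define F where "F m = U i \<inter> (\<Inter>j\<in>{Suc i..<Suc i + m}. N j)" for m
  have F_Suc: "F (Suc m) = F m \<inter> N (Suc i + m)" for m
    unfolding F_def by (auto simp: less_Suc_eq)
  have F: "F m \<in> P \<and> N i \<inter> F m = U (Suc i + m) \<and> N i \<curlyvee> F m = T" for m
  proof (induction m)
    case 0
    then show ?case using U top Suc unfolding F_def by simp
  next
    case (Suc m)
    define n where "n = Suc i + m"
    define G where "G = N n \<inter> F m"
    have F: "F m \<in> P" "N i \<inter> F m = U n" "N i \<curlyvee> F m = T" using Suc.IH unfolding n_def by auto
    have G: "G \<in> P" unfolding G_def by (rule Int_in[OF N F(1)])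
    have FG: "F (Suc m) = G" unfolding F_Suc G_def n_def by blast
    have meet: "N i \<inter> G = U (Suc n)" unfolding G_def using F(2) assms(4)[of n] by blast
    have "F m = (U n \<curlyvee> N n) \<inter> F m"
      using le_top[OF F(1)] top[of n] join_comm[OF U N, of n n] by auto
    also have "\<dots> = U n \<curlyvee> G"
      unfolding G_def by (rule modular[OF U N F(1)]) (use F(2) in blast)
    also have "\<dots> \<subseteq> N i \<curlyvee> G"
      by (rule join_mono[OF U G N G _ subset_refl]) (use F(2) in blast)
    finally have "F m \<subseteq> N i \<curlyvee> G" .
    then have "T \<subseteq> N i \<curlyvee> G"
      using join_least[OF N F(1) join_in[OF N G] join_ge1[OF N G], of i] F(3) by simp
    then have "N i \<curlyvee> G = T" by (rule join_topI[OF N G])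
    then show ?case unfolding FG using G meet n_def by simp
  qed
  define E where "E = \<Inter>(range F)"
  have F_in: "F m \<in> P" and F_meet: "N i \<inter> F m = U (Suc i + m)" and F_top: "N i \<curlyvee> F m = T" for m
    using F[of m] by blast+
  have "E \<in> P" unfolding E_def using F_in by (intro Inter_in) auto
  moreover have "N i \<curlyvee> E = T"
    unfolding E_def by (rule AB5_star_decreasing[OF N F_in _ F_top]) (use F_Suc in blast)
  moreover have "N i \<inter> E = \<Inter>(range U)"
  proof -
    have "N i \<inter> E = (\<Inter>m. N i \<inter> F m)" unfolding E_def by blast
    also have "\<dots> = (\<Inter>m. U (Suc i + m))" unfolding F_meet ..
    also have "\<dots> = \<Inter>(range U)"
    proof (rule equalityI)
      have "U (Suc i + n) \<subseteq> U n" for n by (rule anti) simp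
      then show "(\<Inter>m. U (Suc i + m)) \<subseteq> \<Inter>(range U)" by blast
    qed blast
    finally show ?thesis .
  qed
  moreover have E_le: "E \<subseteq> U i" unfolding E_def F_def by blast
  moreover have "E \<subseteq> N j" if "j \<noteq> i" for j
  proof (cases "j < i")
    case True
    then have "U i \<subseteq> U (Suc j)" by (intro anti) simp
    then show ?thesis using E_le Suc[of j] by blast
  next
    case False
    then have "j \<in> {Suc i..<Suc i + (j - i)}" using that by auto
    then have "F (j - i) \<subseteq> N j" unfolding F_def by blast
    then show ?thesis unfolding E_def by blast
  qed
  ultimately show ?thesis by blast
qed

text \<open>The element \<open>D\<close> is the sum over all \<open>i\<close> of nonzero small pieces \<open>L i\<close> of the independent factors
  \<open>E i\<close>. Its interval over \<open>B\<close> is dense because a piece \<open>L i\<close> lies in \<open>N j\<close> exactly when \<open>j \<noteq> i\<close>, so sums over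
  different index sets are different. It is small over \<open>B\<close> because finitely many
  pieces can be dropped from any cover \<open>D + Y = T\<close>, the remaining ones lie in \<open>U n\<close>, and \<open>AB5*\<close> turns
  \<open>Y + U n = T\<close> for all \<open>n\<close> into \<open>Y + B = T\<close>.\<close>
lemma coindependent_imp_dense_small_over:
  fixes N U :: "nat \<Rightarrow> 'p set"
  assumes N: "\<And>n. N n \<in> P" and U: "\<And>n. U n \<in> P"
    and top: "\<And>n. N n \<curlyvee> U n = T" and Suc: "\<And>n. U (Suc n) = N n \<inter> U n"
    and small: "\<And>n. \<exists>S. small S \<and> \<not> S \<subseteq> N n"
  defines "B \<equiv> \<Inter>(range U)"
  shows "\<exists>D. B \<subseteq> D \<and> small_over B D \<and> dense_interval P B D"
proof -
  have anti: "U n \<subseteq> U m" if "m \<le> n" for m n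
    using that by (induction rule: dec_induct) (use Suc in auto)
  have B_in: "B \<in> P" unfolding B_def using U by (intro Inter_in) auto
  have BU: "B \<subseteq> U n" for n unfolding B_def by blast
  have BN: "B \<subseteq> N n" for n using BU[of "Suc n"] Suc[of n] by blast
  have "\<forall>i. \<exists>E. E \<in> P \<and> N i \<curlyvee> E = T \<and> N i \<inter> E = B \<and> (\<forall>j. j \<noteq> i \<longrightarrow> E \<subseteq> N j) \<and> E \<subseteq> U i"
    unfolding B_def
    by (intro allI coindependent_complement[where N = N and U = U, OF N U top Suc, unfolded Bex_def])
  then obtain E where "\<forall>i. E i \<in> P \<and> N i \<curlyvee> E i = T \<and> N i \<inter> E i = B \<and>
      (\<forall>j. j \<noteq> i \<longrightarrow> E i \<subseteq> N j) \<and> E i \<subseteq> U i" by (rule choice[THEN exE])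
  then have E: "\<And>i. E i \<in> P" "\<And>i. N i \<curlyvee> E i = T" "\<And>i. N i \<inter> E i = B"
    "\<And>i j. j \<noteq> i \<Longrightarrow> E i \<subseteq> N j" "\<And>i. E i \<subseteq> U i" by blast+
  from small have "\<forall>i. \<exists>S. small S \<and> \<not> S \<subseteq> N i" by blast
  then obtain S where "\<forall>i. small (S i) \<and> \<not> S i \<subseteq> N i" by (rule choice[THEN exE])
  then have S: "\<And>i. small (S i)" "\<And>i. \<not> S i \<subseteq> N i" by blast+
  then have S_in: "S i \<in> P" for i unfolding small_over_def by blast
  have SN: "S i \<curlyvee> N i \<in> P" for i by (rule join_in[OF S_in N])
  \<comment> \<open>\<open>L i / B\<close> is the image of \<open>S i\<close> under the projection of \<open>T/B = N i / B \<oplus> E i / B\<close> onto the second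
    summand.\<close>
  define L where "L i = E i \<inter> (S i \<curlyvee> N i)" for i
  have L_in: "L i \<in> P" for i unfolding L_def by (rule Int_in[OF E(1) SN])
  have L_not_le: "\<not> L i \<subseteq> N i" for i
  proof
    assume le: "L i \<subseteq> N i"
    have "S i \<curlyvee> N i = (N i \<curlyvee> E i) \<inter> (S i \<curlyvee> N i)"
      using le_top[OF SN, of i] unfolding E(2) by blast
    also have "\<dots> = N i \<curlyvee> L i"
      unfolding L_def by (rule modular[OF N E(1) SN join_ge2[OF S_in N]])
    also have "\<dots> \<subseteq> N i" by (rule join_least[OF N L_in N subset_refl le])
    finally show False using join_ge1[OF S_in N, of i i] S(2)[of i] by blast
  qed
  have L_le: "L i \<subseteq> N j" if "j \<noteq> i" for i j
    unfolding L_def using E(4)[OF that] by blast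
  have L_small: "small_over B (L i)" for i
    unfolding small_over_def
  proof (intro conjI ballI impI)
    show "L i \<in> P" by (rule L_in)
    fix Y
    assume Y: "Y \<in> P" "B \<subseteq> Y" "L i \<curlyvee> Y = T"
    define W where "W = Y \<inter> E i"
    have W: "W \<in> P" unfolding W_def by (rule Int_in[OF Y(1) E(1)])
    have NW: "N i \<curlyvee> W \<in> P" by (rule join_in[OF N W])
    have SNW: "S i \<curlyvee> (N i \<curlyvee> W) \<in> P" by (rule join_in[OF S_in NW])
    have "E i = (L i \<curlyvee> Y) \<inter> E i" using le_top[OF E(1), of i] unfolding Y(3) by blast
    also have "\<dots> = L i \<curlyvee> W"
      unfolding W_def by (rule modular[OF L_in Y(1) E(1)]) (simp add: L_def)
    also have "\<dots> \<subseteq> S i \<curlyvee> (N i \<curlyvee> W)"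
    proof (rule join_least[OF L_in W SNW])
      have "L i \<subseteq> S i \<curlyvee> N i" unfolding L_def by blast
      also have "\<dots> \<subseteq> S i \<curlyvee> (N i \<curlyvee> W)"
        by (rule join_mono[OF S_in N S_in NW subset_refl join_ge1[OF N W]])
      finally show "L i \<subseteq> S i \<curlyvee> (N i \<curlyvee> W)" .
      show "W \<subseteq> S i \<curlyvee> (N i \<curlyvee> W)"
        using join_ge2[OF N W] join_ge2[OF S_in NW] by (rule order_trans)
    qed
    finally have "E i \<subseteq> S i \<curlyvee> (N i \<curlyvee> W)" .
    moreover have "N i \<subseteq> S i \<curlyvee> (N i \<curlyvee> W)"
      using join_ge1[OF N W] join_ge2[OF S_in NW] by (rule order_trans)
    ultimately have "N i \<curlyvee> E i \<subseteq> S i \<curlyvee> (N i \<curlyvee> W)"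
      by (intro join_least[OF N E(1) SNW])
    then have "T \<subseteq> S i \<curlyvee> (N i \<curlyvee> W)" unfolding E(2) .
    then have "S i \<curlyvee> (N i \<curlyvee> W) = T" by (rule join_topI[OF S_in NW])
    then have NWT: "N i \<curlyvee> W = T"
      using S(1)[of i] NW bot_le[OF NW] unfolding small_over_def by blast
    have "E i = (W \<curlyvee> N i) \<inter> E i"
      using le_top[OF E(1), of i] NWT join_comm[OF N W, of i] by auto
    also have "\<dots> = W \<curlyvee> (N i \<inter> E i)"
      by (rule modular[OF W N E(1)]) (simp add: W_def)
    also have "\<dots> = W \<curlyvee> B" unfolding E(3) ..
    also have "\<dots> \<subseteq> Y" by (rule join_least[OF W B_in Y(1) _ Y(2)]) (simp add: W_def)
    finally have "L i \<subseteq> Y" unfolding L_def by blast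
    then show "Y = T" using join_absorb[OF L_in Y(1)] Y(3) by simp
  qed
  \<comment> \<open>the join of \<open>B\<close> and the \<open>L i\<close> with \<open>i \<in> A\<close>\<close>
  define D where "D A = \<Inter>{Y \<in> P. B \<subseteq> Y \<and> (\<forall>i\<in>A. L i \<subseteq> Y)}" for A
  have D_in: "D A \<in> P" for A
    unfolding D_def
  proof (rule Inter_in)
    have "T \<in> {Y \<in> P. B \<subseteq> Y \<and> (\<forall>i\<in>A. L i \<subseteq> Y)}"
      using top_in le_top[OF L_in] le_top[OF B_in] by simp
    then show "{Y \<in> P. B \<subseteq> Y \<and> (\<forall>i\<in>A. L i \<subseteq> Y)} \<noteq> {}" by blast
  qed blast
  have D_ge: "L i \<subseteq> D A" if "i \<in> A" for i A unfolding D_def using that by blast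
  have B_le: "B \<subseteq> D A" for A unfolding D_def by blast
  have D_least: "D A \<subseteq> Y" if "Y \<in> P" "B \<subseteq> Y" "\<And>i. i \<in> A \<Longrightarrow> L i \<subseteq> Y" for A Y
    unfolding D_def using that by blast
  have D_mono: "D A \<subseteq> D A'" if "A \<subseteq> A'" for A A'
    by (rule D_least[OF D_in B_le D_ge]) (use that in blast)
  have D_strict: "D A \<subset> D A'" if "A \<subseteq> A'" "i \<in> A'" "i \<notin> A" for A A' i
  proof -
    have "D A \<subseteq> N i" by (rule D_least[OF N BN L_le]) (use that in blast)
    then have "\<not> D A' \<subseteq> D A" using D_ge[OF that(2)] L_not_le[of i] by blast
    then show ?thesis using D_mono[OF that(1)] by blast
  qed
  have "dense_interval P B (D UNIV)"
  proof (rule dense_interval_rat_chain)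
    show "strict_mono (\<lambda>q. D {i. nat_to_rat_surj i < q})"
    proof (rule strict_monoI)
      fix p q :: rat
      assume pq: "p < q"
      obtain i where i: "p = nat_to_rat_surj i" using surj_nat_to_rat_surj by (rule surjE)
      show "D {i. nat_to_rat_surj i < p} \<subset> D {i. nat_to_rat_surj i < q}"
        by (rule D_strict[of _ _ i]) (use pq i in auto)
    qed
  qed (simp_all add: D_in B_le D_mono)
  moreover have "small_over B (D UNIV)"
    unfolding small_over_def
  proof (intro conjI ballI impI)
    show "D UNIV \<in> P" by (rule D_in)
    fix Y
    assume Y: "Y \<in> P" "B \<subseteq> Y" "D UNIV \<curlyvee> Y = T"
    \<comment> \<open>one piece is dropped at a time, by its smallness over \<open>B\<close>\<close>
    have tail: "D {n..} \<curlyvee> Y = T" for n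
    proof (induction n)
      case 0
      then show ?case using Y(3) by (simp add: atLeast_0)
    next
      case (Suc n)
      define V where "V = D {Suc n..} \<curlyvee> Y"
      have V: "V \<in> P" unfolding V_def by (rule join_in[OF D_in Y(1)])
      have LV: "L n \<curlyvee> V \<in> P" by (rule join_in[OF L_in V])
      have Y_le: "Y \<subseteq> V" unfolding V_def by (rule join_ge2[OF D_in Y(1)])
      have D_le: "D {Suc n..} \<subseteq> V" unfolding V_def by (rule join_ge1[OF D_in Y(1)])
      have V_le: "V \<subseteq> L n \<curlyvee> V" by (rule join_ge2[OF L_in V])
      have "D {n..} \<subseteq> L n \<curlyvee> V"
      proof (rule D_least[OF LV])
        show "B \<subseteq> L n \<curlyvee> V" using Y(2) Y_le V_le by blast
        fix i
        assume "i \<in> {n..}"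
        then consider "i = n" | "i \<in> {Suc n..}" by fastforce
        then show "L i \<subseteq> L n \<curlyvee> V"
        proof cases
          case 1
          then show ?thesis using join_ge1[OF L_in V, of n] by simp
        next
          case 2
          then show ?thesis using D_ge[OF 2] D_le V_le by blast
        qed
      qed
      moreover have "Y \<subseteq> L n \<curlyvee> V" using Y_le V_le by blast
      ultimately have "D {n..} \<curlyvee> Y \<subseteq> L n \<curlyvee> V"
        by (intro join_least[OF D_in Y(1) LV])
      then have "T \<subseteq> L n \<curlyvee> V" unfolding Suc.IH .
      then have "L n \<curlyvee> V = T" by (rule join_topI[OF L_in V])
      moreover have "B \<subseteq> V" using Y(2) Y_le by blast
      ultimately show ?case using L_small[of n] V unfolding small_over_def V_def by blast
    qed
    have "Y \<curlyvee> \<Inter>(range U) = T"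
    proof (rule AB5_star_decreasing[OF Y(1) U])
      show "U (Suc n) \<subseteq> U n" for n using Suc[of n] by blast
      show "Y \<curlyvee> U n = T" for n
      proof -
        have "D {n..} \<subseteq> U n"
        proof (rule D_least[OF U BU])
          fix i
          assume "i \<in> {n..}"
          then show "L i \<subseteq> U n" unfolding L_def using E(5)[of i] anti[of n i] by auto
        qed
        then show ?thesis
          using join_top_mono[OF tail D_in Y(1) U Y(1) _ subset_refl, of n n] join_comm[OF Y(1) U, of n]
          by simp
      qed
    qed
    then have "B \<curlyvee> Y = T" using join_comm[OF B_in Y(1)] unfolding B_def by simp
    then show "Y = T" using join_absorb[OF B_in Y(1,2)] by simp
  qed
  ultimately show ?thesis using B_le by blast
qed

text \<open>The element \<open>J\<close> enters only through its supplement \<open>K\<close>: the whole construction takes place above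
  \<open>K\<close>, where every proper element fails to contain some small element.\<close>
theorem not_dense_interval_Sup_small:
  assumes small: "\<And>S. small S \<Longrightarrow> \<not> dense_interval P Z S"
    and J: "J \<in> P" and J_least: "\<And>Y. \<lbrakk>Y \<in> P; \<And>S. small S \<Longrightarrow> S \<subseteq> Y\<rbrakk> \<Longrightarrow> J \<subseteq> Y"
  shows "\<not> dense_interval P Z J"
proof
  assume dense: "dense_interval P Z J"
  obtain K where suppl: "supplement J K" using supplement_exists[OF J] ..
  then have K: "K \<in> P" and JK: "J \<curlyvee> K = T" unfolding supplement_def by auto
  have JiK: "J \<inter> K \<in> P" by (rule Int_in[OF J K])
  \<comment> \<open>\<open>J\<close> is trivially small over itself, so meeting it with its supplement gives a small element.\<close>
  have "small_over J J" unfolding small_over_def using J join_absorb by auto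
  then have "small (J \<inter> K)" by (rule small_Int_supplement[OF J suppl])
  then have "\<not> dense_interval P Z (J \<inter> K)" by (rule small)
  then have dJ: "dense_interval P (J \<inter> K) J"
    using dense_interval_split[OF bot_in JiK J bot_le[OF JiK] Int_lower1 dense] by blast
  have "dense_interval P K T"
  proof -
    have cancel: "(K \<curlyvee> u) \<inter> J = u" if u: "u \<in> P" "J \<inter> K \<subseteq> u" "u \<subseteq> J" for u
    proof -
      have "(u \<curlyvee> K) \<inter> J = u \<curlyvee> (K \<inter> J)" by (rule modular[OF u(1) K J u(3)])
      also have "\<dots> = (J \<inter> K) \<curlyvee> u" using join_comm[OF JiK u(1)] by (simp add: Int_commute)
      also have "\<dots> = u" by (rule join_absorb[OF JiK u(1,2)])
      finally show ?thesis using join_comm[OF K u(1)] by simp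
    qed
    have "dense_interval P (K \<curlyvee> (J \<inter> K)) (K \<curlyvee> J)"
      using dJ JiK J
    proof (rule dense_interval_image[where g = "\<lambda>u. K \<curlyvee> u"])
      fix u v
      assume uv: "u \<in> P" "v \<in> P" "J \<inter> K \<subseteq> u" "v \<subseteq> J" "u \<subset> v"
      then have "J \<inter> K \<subseteq> v" "u \<subseteq> J" by blast+
      then have "(K \<curlyvee> u) \<inter> J = u" "(K \<curlyvee> v) \<inter> J = v"
        using cancel[OF uv(1,3)] cancel[OF uv(2) _ uv(4)] by blast+
      then have "K \<curlyvee> u \<noteq> K \<curlyvee> v" using uv(5) by auto
      moreover have "K \<curlyvee> u \<subseteq> K \<curlyvee> v" using uv K by (intro join_mono) auto
      ultimately show "K \<curlyvee> u \<subset> K \<curlyvee> v" by blast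
    qed (rule join_in[OF K])
    then show ?thesis
      by (rule dense_interval_mono) (simp_all add: join_ge1 K JiK le_top join_in J)
  qed
  have "\<exists>U. \<forall>n :: nat. (U n \<in> P \<and> K \<subseteq> U n \<and> dense_interval P K (U n)) \<and>
      (\<exists>N\<in>P. K \<subseteq> N \<and> N \<noteq> T \<and> N \<curlyvee> U n = T \<and> U (Suc n) = N \<inter> U n)"
  proof (rule dependent_nat_choice)
    show "\<exists>V. V \<in> P \<and> K \<subseteq> V \<and> dense_interval P K V"
      using \<open>dense_interval P K T\<close> top_in le_top[OF K] by blast
  next
    fix V and n :: nat
    assume "V \<in> P \<and> K \<subseteq> V \<and> dense_interval P K V"
    then have V: "V \<in> P" "K \<subseteq> V" "dense_interval P K V" by blast+
    obtain N where N: "N \<in> P" "K \<subseteq> N" "N \<noteq> T" "N \<curlyvee> V = T" "dense_interval P K (N \<inter> V)"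
      using dense_interval_shrink[OF small K V] by blast
    have "N \<inter> V \<in> P" using N(1) V(1) by (rule Int_in)
    then show "\<exists>V'. (V' \<in> P \<and> K \<subseteq> V' \<and> dense_interval P K V') \<and>
        (\<exists>N\<in>P. K \<subseteq> N \<and> N \<noteq> T \<and> N \<curlyvee> V = T \<and> V' = N \<inter> V)"
      using N V by (intro exI[of _ "N \<inter> V"] conjI bexI[of _ N]) simp_all
  qed
  then obtain U where U_props: "\<forall>n :: nat. (U n \<in> P \<and> K \<subseteq> U n \<and> dense_interval P K (U n)) \<and>
      (\<exists>N\<in>P. K \<subseteq> N \<and> N \<noteq> T \<and> N \<curlyvee> U n = T \<and> U (Suc n) = N \<inter> U n)" ..
  then have U: "U n \<in> P" for n by simp
  from U_props have ex: "\<forall>n. \<exists>N. N \<in> P \<and> K \<subseteq> N \<and> N \<noteq> T \<and> N \<curlyvee> U n = T \<and> U (Suc n) = N \<inter> U n"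
    unfolding Bex_def by simp
  from ex obtain N where "\<forall>n. N n \<in> P \<and> K \<subseteq> N n \<and> N n \<noteq> T \<and> N n \<curlyvee> U n = T \<and> U (Suc n) = N n \<inter> U n"
    by (rule choice[THEN exE])
  then have N: "\<And>n. N n \<in> P" "\<And>n. K \<subseteq> N n" "\<And>n. N n \<noteq> T" "\<And>n. N n \<curlyvee> U n = T"
    "\<And>n. U (Suc n) = N n \<inter> U n" by blast+
  have "\<exists>S. small S \<and> \<not> S \<subseteq> N n" for n
  proof (rule ccontr)
    assume "\<not> ?thesis"
    then have "J \<subseteq> N n" by (intro J_least[OF N(1)]) blast
    then have "J \<curlyvee> K \<subseteq> N n" by (intro join_least[OF J K N(1) _ N(2)])
    then have "T \<subseteq> N n" unfolding JK .
    then show False using N(3)[of n] le_top[OF N(1), of n] by blast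
  qed
  then obtain D where "\<Inter>(range U) \<subseteq> D" "small_over (\<Inter>(range U)) D" "dense_interval P (\<Inter>(range U)) D"
    using coindependent_imp_dense_small_over[where N = N and U = U, OF N(1) U N(4,5)] by blast
  moreover have "\<Inter>(range U) \<in> P" using U by (intro Inter_in) auto
  ultimately show False using not_dense_interval_if_small_over[OF small, of "\<Inter>(range U)" D] by blast
qed

end

section \<open>The lattice of submodules\<close>

lemma (in left_module) submoduleI:
  assumes "H \<subseteq> carrier M" and "\<zero>\<^bsub>M\<^esub> \<in> H"
    and "\<And>x. x \<in> H \<Longrightarrow> \<ominus>\<^bsub>M\<^esub> x \<in> H"
    and "\<And>x y. \<lbrakk>x \<in> H; y \<in> H\<rbrakk> \<Longrightarrow> x \<oplus>\<^bsub>M\<^esub> y \<in> H"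
    and "\<And>a x. \<lbrakk>a \<in> carrier R; x \<in> H\<rbrakk> \<Longrightarrow> a \<odot>\<^bsub>M\<^esub> x \<in> H"
  shows "submodule H R M"
  by (intro submodule.intro subgroup.intro submodule_axioms.intro)
    (use assms in \<open>simp_all add: a_inv_def\<close>)

lemma (in left_module) submoduleD:
  assumes "submodule H R M"
  shows "H \<subseteq> carrier M" and "\<zero>\<^bsub>M\<^esub> \<in> H"
    and "\<And>x. x \<in> H \<Longrightarrow> \<ominus>\<^bsub>M\<^esub> x \<in> H"
    and "\<And>x y. \<lbrakk>x \<in> H; y \<in> H\<rbrakk> \<Longrightarrow> x \<oplus>\<^bsub>M\<^esub> y \<in> H"
    and "\<And>a x. \<lbrakk>a \<in> carrier R; x \<in> H\<rbrakk> \<Longrightarrow> a \<odot>\<^bsub>M\<^esub> x \<in> H"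
proof -
  have sg: "subgroup H (add_monoid M)" using assms by (rule submodule.axioms)
  show "H \<subseteq> carrier M" using subgroup.subset[OF sg] by simp
  show "\<zero>\<^bsub>M\<^esub> \<in> H" using subgroup.one_closed[OF sg] by simp
  show "\<ominus>\<^bsub>M\<^esub> x \<in> H" if "x \<in> H" for x
    using subgroup.m_inv_closed[OF sg that] by (simp add: a_inv_def)
  show "x \<oplus>\<^bsub>M\<^esub> y \<in> H" if "x \<in> H" "y \<in> H" for x y
    using subgroup.m_closed[OF sg that] by simp
  show "a \<odot>\<^bsub>M\<^esub> x \<in> H" if "a \<in> carrier R" "x \<in> H" for a x
    using assms that by (rule submodule.smult_closed)
qed

text \<open>The submodule predicate refers to the negation of the ambient structure, which has to be
  compared with that of the restricted one.\<close>
lemma (in left_module) submodule_of_submodule_iff: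
  assumes N: "submodule N R M"
  shows "submodule H R (M\<lparr>carrier := N\<rparr>) \<longleftrightarrow> submodule H R M \<and> H \<subseteq> N"
proof -
  have grp: "group (add_monoid M)" by (rule M.a_group)
  have sgN: "subgroup N (add_monoid M)" using N by (rule submodule.axioms)
  have inv: "inv\<^bsub>add_monoid (M\<lparr>carrier := N\<rparr>)\<^esub> x = inv\<^bsub>add_monoid M\<^esub> x" if "x \<in> N" for x
    using group.m_inv_consistent[OF grp sgN that] by simp
  have "subgroup H (add_monoid (M\<lparr>carrier := N\<rparr>)) \<longleftrightarrow> subgroup H (add_monoid M) \<and> H \<subseteq> N"
  proof (intro iffI conjI)
    assume H: "subgroup H (add_monoid (M\<lparr>carrier := N\<rparr>))"
    show HN: "H \<subseteq> N" using subgroup.subset[OF H] by simp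
    show "subgroup H (add_monoid M)"
    proof (rule subgroup.intro)
      show "H \<subseteq> carrier (add_monoid M)" using HN submoduleD(1)[OF N] by simp
      show "x \<otimes>\<^bsub>add_monoid M\<^esub> y \<in> H" if "x \<in> H" "y \<in> H" for x y
        using subgroup.m_closed[OF H that] by simp
      show "\<one>\<^bsub>add_monoid M\<^esub> \<in> H" using subgroup.one_closed[OF H] by simp
      show "inv\<^bsub>add_monoid M\<^esub> x \<in> H" if "x \<in> H" for x
        using subgroup.m_inv_closed[OF H that] inv[of x] that HN by auto
    qed
  next
    assume "subgroup H (add_monoid M) \<and> H \<subseteq> N"
    then have H: "subgroup H (add_monoid M)" and HN: "H \<subseteq> N" by auto
    show "subgroup H (add_monoid (M\<lparr>carrier := N\<rparr>))"
    proof (rule subgroup.intro)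
      show "H \<subseteq> carrier (add_monoid (M\<lparr>carrier := N\<rparr>))" using HN by simp
      show "x \<otimes>\<^bsub>add_monoid (M\<lparr>carrier := N\<rparr>)\<^esub> y \<in> H" if "x \<in> H" "y \<in> H" for x y
        using subgroup.m_closed[OF H that] by simp
      show "\<one>\<^bsub>add_monoid (M\<lparr>carrier := N\<rparr>)\<^esub> \<in> H" using subgroup.one_closed[OF H] by simp
      show "inv\<^bsub>add_monoid (M\<lparr>carrier := N\<rparr>)\<^esub> x \<in> H" if "x \<in> H" for x
        using subgroup.m_inv_closed[OF H that] inv[of x] that HN by auto
    qed
  qed
  then show ?thesis by (auto simp: submodule_def submodule_axioms_def)
qed

lemma (in left_module) submodule_zero: "submodule {\<zero>\<^bsub>M\<^esub>} R M"
proof (rule submoduleI)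
  fix a x
  assume "a \<in> carrier R" and "x \<in> {\<zero>\<^bsub>M\<^esub>}"
  then have "x = \<zero>\<^bsub>M\<^esub>" and a: "a \<odot>\<^bsub>M\<^esub> \<zero>\<^bsub>M\<^esub> \<in> carrier M" by auto
  moreover have "a \<odot>\<^bsub>M\<^esub> \<zero>\<^bsub>M\<^esub> = a \<odot>\<^bsub>M\<^esub> \<zero>\<^bsub>M\<^esub> \<oplus>\<^bsub>M\<^esub> a \<odot>\<^bsub>M\<^esub> \<zero>\<^bsub>M\<^esub>"
    using smult_r_distr[OF \<open>a \<in> carrier R\<close>, of "\<zero>\<^bsub>M\<^esub>" "\<zero>\<^bsub>M\<^esub>"] by simp
  ultimately show "a \<odot>\<^bsub>M\<^esub> x \<in> {\<zero>\<^bsub>M\<^esub>}"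
    using M.add.l_cancel_one'[OF a a] by simp
qed auto

lemma (in left_module) set_add_memI: "\<lbrakk>h \<in> H; k \<in> K\<rbrakk> \<Longrightarrow> h \<oplus>\<^bsub>M\<^esub> k \<in> H <+>\<^bsub>M\<^esub> K"
  unfolding set_add_def' by blast

lemma (in left_module) set_add_memE:
  assumes "u \<in> H <+>\<^bsub>M\<^esub> K"
  obtains h k where "h \<in> H" "k \<in> K" "u = h \<oplus>\<^bsub>M\<^esub> k"
  using assms unfolding set_add_def' by blast

text \<open>This reduces the theorem to density in the one lattice of all submodules of \<open>M\<close>.\<close>
lemma (in left_module) has_krull_dimension_submodule_iff:
  assumes N: "submodule N R M"
  shows "has_krull_dimension R (M\<lparr>carrier := N\<rparr>)
    \<longleftrightarrow> \<not> dense_interval {H. submodule H R M} {\<zero>\<^bsub>M\<^esub>} N"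
proof -
  define P where "P = {H. submodule H R M}"
  define Q where "Q = {H. submodule H R (M\<lparr>carrier := N\<rparr>)}"
  have Q: "Q = {H \<in> P. H \<subseteq> N}"
    unfolding P_def Q_def using submodule_of_submodule_iff[OF N] by blast
  have in_Q: "{\<zero>\<^bsub>M\<^esub>} \<in> Q" "N \<in> Q" and le: "{\<zero>\<^bsub>M\<^esub>} \<subseteq> N"
    unfolding Q P_def using submodule_zero N submoduleD(2)[OF N] by auto
  have PQ: "dense_interval Q {\<zero>\<^bsub>M\<^esub>} N" if "dense_interval P {\<zero>\<^bsub>M\<^esub>} N"
    using dense_interval_image[where g = "\<lambda>x. x", OF that, of Q] in_Q unfolding Q by blast
  have QP: "dense_interval P {\<zero>\<^bsub>M\<^esub>} N" if "dense_interval Q {\<zero>\<^bsub>M\<^esub>} N"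
    using dense_interval_image[where g = "\<lambda>x. x", OF that, of P] in_Q unfolding Q by blast
  have "has_krull_dimension R (M\<lparr>carrier := N\<rparr>) \<longleftrightarrow>
      {\<zero>\<^bsub>M\<^esub>} = N \<or> (\<exists>\<alpha> :: ('b set \<times> 'b set) set rel. deviation Q \<alpha> {\<zero>\<^bsub>M\<^esub>} N)"
    unfolding has_krull_dimension_def krull_dimension_def Q_def by (auto simp: eq_commute)
  also have "\<dots> \<longleftrightarrow> \<not> dense_interval Q {\<zero>\<^bsub>M\<^esub>} N"
    using deviation_or_dense_interval[OF in_Q le] not_dense_interval_if_deviation[of Q _ "{\<zero>\<^bsub>M\<^esub>}" N]
      dense_interval_less[of Q "{\<zero>\<^bsub>M\<^esub>}" N] by blast
  also have "\<dots> \<longleftrightarrow> \<not> dense_interval P {\<zero>\<^bsub>M\<^esub>} N" using PQ QP by blast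
  finally show ?thesis unfolding P_def .
qed

lemma (in left_module) AB5_star_lattice_submodules:
  assumes AB5: "AB5_star R M"
  shows "AB5_star_lattice {N. submodule N R M} (carrier M) {\<zero>\<^bsub>M\<^esub>} (set_add M)"
proof unfold_locales
  note D = submoduleD
  show "carrier M \<in> {N. submodule N R M}" by (auto intro: submoduleI)
  show "{\<zero>\<^bsub>M\<^esub>} \<in> {N. submodule N R M}" using submodule_zero by blast
  show "x \<subseteq> carrier M" if "x \<in> {N. submodule N R M}" for x
    using that D(1) by blast
  show "{\<zero>\<^bsub>M\<^esub>} \<subseteq> x" if "x \<in> {N. submodule N R M}" for x
    using that D(2) by blast
  show "\<Inter>\<A> \<in> {N. submodule N R M}" if "\<A> \<subseteq> {N. submodule N R M}" "\<A> \<noteq> {}" for \<A>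
  proof -
    have sub: "submodule H R M" if "H \<in> \<A>" for H using that \<open>\<A> \<subseteq> _\<close> by blast
    obtain H where "H \<in> \<A>" using \<open>\<A> \<noteq> {}\<close> by blast
    have "submodule (\<Inter>\<A>) R M"
    proof (rule submoduleI)
      show "\<Inter>\<A> \<subseteq> carrier M" using \<open>H \<in> \<A>\<close> D(1)[OF sub] by blast
    qed (use D(2-5)[OF sub] in simp_all)
    then show ?thesis by simp
  qed
  fix x y
  assume "x \<in> {N. submodule N R M}" "y \<in> {N. submodule N R M}"
  then have x: "submodule x R M" and y: "submodule y R M" by auto
  note cx = subsetD[OF D(1)[OF x]] and cy = subsetD[OF D(1)[OF y]]
  show ge1: "x \<subseteq> x <+>\<^bsub>M\<^esub> y"
  proof
    fix h
    assume "h \<in> x"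
    then show "h \<in> x <+>\<^bsub>M\<^esub> y"
      using set_add_memI[of h x "\<zero>\<^bsub>M\<^esub>" y] D(2)[OF y] cx[of h] by simp
  qed
  show ge2: "y \<subseteq> x <+>\<^bsub>M\<^esub> y"
  proof
    fix h
    assume "h \<in> y"
    then show "h \<in> x <+>\<^bsub>M\<^esub> y"
      using set_add_memI[of "\<zero>\<^bsub>M\<^esub>" x h y] D(2)[OF x] cy[of h] by simp
  qed
  show "x <+>\<^bsub>M\<^esub> y \<in> {N. submodule N R M}"
  proof (rule CollectI, rule submoduleI)
    show "x <+>\<^bsub>M\<^esub> y \<subseteq> carrier M"
      using cx cy by (auto elim!: set_add_memE)
    show "\<zero>\<^bsub>M\<^esub> \<in> x <+>\<^bsub>M\<^esub> y" using ge1 D(2)[OF x] by blast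
  next
    fix u
    assume "u \<in> x <+>\<^bsub>M\<^esub> y"
    then obtain h k where hk: "h \<in> x" "k \<in> y" "u = h \<oplus>\<^bsub>M\<^esub> k" by (rule set_add_memE)
    have "\<ominus>\<^bsub>M\<^esub> u = \<ominus>\<^bsub>M\<^esub> h \<oplus>\<^bsub>M\<^esub> \<ominus>\<^bsub>M\<^esub> k"
      using cx[OF hk(1)] cy[OF hk(2)] hk(3) by (simp add: M.minus_add)
    then show "\<ominus>\<^bsub>M\<^esub> u \<in> x <+>\<^bsub>M\<^esub> y"
      using set_add_memI[OF D(3)[OF x hk(1)] D(3)[OF y hk(2)]] by simp
  next
    fix u v
    assume "u \<in> x <+>\<^bsub>M\<^esub> y" "v \<in> x <+>\<^bsub>M\<^esub> y"
    then obtain h k h' k' where hk: "h \<in> x" "k \<in> y" "u = h \<oplus>\<^bsub>M\<^esub> k"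
      and hk': "h' \<in> x" "k' \<in> y" "v = h' \<oplus>\<^bsub>M\<^esub> k'" by (elim set_add_memE)
    have "u \<oplus>\<^bsub>M\<^esub> v = (h \<oplus>\<^bsub>M\<^esub> h') \<oplus>\<^bsub>M\<^esub> (k \<oplus>\<^bsub>M\<^esub> k')"
      using cx[OF hk(1)] cy[OF hk(2)] cx[OF hk'(1)] cy[OF hk'(2)] hk(3) hk'(3)
      by (simp add: M.a_ac)
    then show "u \<oplus>\<^bsub>M\<^esub> v \<in> x <+>\<^bsub>M\<^esub> y"
      using set_add_memI[OF D(4)[OF x hk(1) hk'(1)] D(4)[OF y hk(2) hk'(2)]] by simp
  next
    fix a u
    assume a: "a \<in> carrier R" and "u \<in> x <+>\<^bsub>M\<^esub> y"
    then obtain h k where hk: "h \<in> x" "k \<in> y" "u = h \<oplus>\<^bsub>M\<^esub> k" by (elim set_add_memE)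
    have "a \<odot>\<^bsub>M\<^esub> u = a \<odot>\<^bsub>M\<^esub> h \<oplus>\<^bsub>M\<^esub> a \<odot>\<^bsub>M\<^esub> k"
      unfolding hk(3) using a cx[OF hk(1)] cy[OF hk(2)] by (rule smult_r_distr)
    then show "a \<odot>\<^bsub>M\<^esub> u \<in> x <+>\<^bsub>M\<^esub> y"
      using set_add_memI[OF D(5)[OF x a hk(1)] D(5)[OF y a hk(2)]] by simp
  qed
  fix z
  assume "z \<in> {N. submodule N R M}"
  then have z: "submodule z R M" by blast
  show "x <+>\<^bsub>M\<^esub> y \<subseteq> z" if "x \<subseteq> z" "y \<subseteq> z"
    using that D(4)[OF z] by (auto elim!: set_add_memE)
  show "(x <+>\<^bsub>M\<^esub> y) \<inter> z \<subseteq> x <+>\<^bsub>M\<^esub> (y \<inter> z)" if "x \<subseteq> z"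
  proof
    fix u
    assume "u \<in> (x <+>\<^bsub>M\<^esub> y) \<inter> z"
    then obtain h k where hk: "h \<in> x" "k \<in> y" "u = h \<oplus>\<^bsub>M\<^esub> k" and u: "u \<in> z"
      by (auto elim: set_add_memE)
    have "\<ominus>\<^bsub>M\<^esub> h \<oplus>\<^bsub>M\<^esub> u = k"
      unfolding hk(3) using cx[OF hk(1)] cy[OF hk(2)] by (rule M.r_neg1)
    moreover have "\<ominus>\<^bsub>M\<^esub> h \<oplus>\<^bsub>M\<^esub> u \<in> z"
      using D(4)[OF z D(3)[OF z subsetD[OF that hk(1)]] u] .
    ultimately have "k \<in> y \<inter> z" using hk(2) by simp
    then show "u \<in> x <+>\<^bsub>M\<^esub> (y \<inter> z)" unfolding hk(3) using hk(1) by (intro set_add_memI)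
  qed
next
  fix x \<A>
  assume "x \<in> {N. submodule N R M}" and "\<A> \<subseteq> {N. submodule N R M}" "\<A> \<noteq> {}"
    and "\<And>a b. \<lbrakk>a \<in> \<A>; b \<in> \<A>\<rbrakk> \<Longrightarrow> \<exists>c\<in>\<A>. c \<subseteq> a \<inter> b"
  then show "x <+>\<^bsub>M\<^esub> \<Inter>\<A> = (\<Inter>a\<in>\<A>. x <+>\<^bsub>M\<^esub> a)"
    by (intro AB5[unfolded AB5_star_def, rule_format]) auto
qed

lemma (in left_module) small_submodule_iff:
  assumes "AB5_star_lattice {N. submodule N R M} (carrier M) {\<zero>\<^bsub>M\<^esub>} (set_add M)"
  shows "small_submodule R M N \<longleftrightarrow>
    AB5_star_lattice.small_over {N. submodule N R M} (carrier M) (set_add M) {\<zero>\<^bsub>M\<^esub>} N"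
  unfolding small_submodule_def AB5_star_lattice.small_over_def[OF assms]
  using submoduleD(2) by auto

text \<open>A finite sum of small submodules is small, so each element of the radical already lies in a single
  small submodule.\<close>
lemma (in left_module) Rad_eq_Union_small:
  assumes lattice: "AB5_star_lattice {N. submodule N R M} (carrier M) {\<zero>\<^bsub>M\<^esub>} (set_add M)"
  shows "Rad R M = \<Union>{N. small_submodule R M N}"
proof (intro equalityI subsetI)
  fix u
  assume "u \<in> Rad R M"
  then obtain x \<F> where u: "u = finsum M x \<F>" and \<F>: "finite \<F>" "\<F> \<subseteq> {N. small_submodule R M N}"
    "\<forall>N\<in>\<F>. x N \<in> N" unfolding Rad_def sum_of_submodules_def by blast
  from \<F> have "\<exists>S. small_submodule R M S \<and> finsum M x \<F> \<in> S"
  proof (induction \<F> rule: finite_induct)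
    case empty
    have "small_submodule R M {\<zero>\<^bsub>M\<^esub>}"
      using AB5_star_lattice.small_bot[OF lattice] small_submodule_iff[OF lattice] by blast
    then show ?case by (intro exI[of _ "{\<zero>\<^bsub>M\<^esub>}"]) simp
  next
    case (insert N \<F>)
    then obtain S where S: "small_submodule R M S" "finsum M x \<F> \<in> S" by auto
    have N: "small_submodule R M N" "x N \<in> N" using insert.prems by auto
    have car: "x L \<in> carrier M" if "L \<in> insert N \<F>" for L
      using insert.prems that submoduleD(1)[of L] unfolding small_submodule_def by blast
    have "finsum M x (insert N \<F>) = x N \<oplus>\<^bsub>M\<^esub> finsum M x \<F>"
      using insert.hyps car by (intro M.finsum_insert) auto
    then have "finsum M x (insert N \<F>) \<in> N <+>\<^bsub>M\<^esub> S"
      using set_add_memI[OF N(2) S(2)] by simp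
    moreover have "small_submodule R M (N <+>\<^bsub>M\<^esub> S)"
      using AB5_star_lattice.small_join[OF lattice] N(1) S(1) small_submodule_iff[OF lattice] by simp
    ultimately show ?case by blast
  qed
  then show "u \<in> \<Union>{N. small_submodule R M N}" unfolding u by blast
next
  fix u
  assume "u \<in> \<Union>{N. small_submodule R M N}"
  then obtain N where N: "small_submodule R M N" "u \<in> N" by blast
  then have "u \<in> carrier M" using submoduleD(1) unfolding small_submodule_def by blast
  then have "u = finsum M (\<lambda>_. u) {N}" by simp
  then show "u \<in> Rad R M" unfolding Rad_def sum_of_submodules_def using N
    by (intro CollectI exI[of _ "\<lambda>_. u"] exI[of _ "{N}"]) simp
qed

lemma (in left_module) submodule_Rad:
  assumes lattice: "AB5_star_lattice {N. submodule N R M} (carrier M) {\<zero>\<^bsub>M\<^esub>} (set_add M)"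
  shows "submodule (Rad R M) R M"
  unfolding Rad_eq_Union_small[OF lattice]
proof (rule submoduleI)
  note small_iff = small_submodule_iff[OF lattice]
  have sub: "submodule N R M" if "small_submodule R M N" for N
    using that unfolding small_submodule_def by blast
  show "\<Union>{N. small_submodule R M N} \<subseteq> carrier M" using submoduleD(1)[OF sub] by blast
  have "small_submodule R M {\<zero>\<^bsub>M\<^esub>}"
    using AB5_star_lattice.small_bot[OF lattice] small_iff by blast
  then show "\<zero>\<^bsub>M\<^esub> \<in> \<Union>{N. small_submodule R M N}" by blast
  show "\<ominus>\<^bsub>M\<^esub> u \<in> \<Union>{N. small_submodule R M N}" if "u \<in> \<Union>{N. small_submodule R M N}" for u
    using that submoduleD(3)[OF sub] by blast
  show "a \<odot>\<^bsub>M\<^esub> u \<in> \<Union>{N. small_submodule R M N}"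
    if "a \<in> carrier R" "u \<in> \<Union>{N. small_submodule R M N}" for a u
    using that submoduleD(5)[OF sub] by blast
  fix u v
  assume "u \<in> \<Union>{N. small_submodule R M N}" "v \<in> \<Union>{N. small_submodule R M N}"
  then obtain S S' where S: "small_submodule R M S" "u \<in> S" "small_submodule R M S'" "v \<in> S'" by blast
  have "small_submodule R M (S <+>\<^bsub>M\<^esub> S')"
    using AB5_star_lattice.small_join[OF lattice] S(1,3) small_iff by simp
  then show "u \<oplus>\<^bsub>M\<^esub> v \<in> \<Union>{N. small_submodule R M N}"
    using set_add_memI[OF S(2,4)] by blast
qed

theorem theorem7:
  fixes R :: "('a, 'r) ring_scheme" and M :: "('a, 'b, 'm) module_scheme"
  assumes "left_module R M"
    and "AB5_star R M"
    and "\<And>N. small_submodule R M N \<Longrightarrow> has_krull_dimension R (M\<lparr>carrier := N\<rparr>)"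
  shows "has_krull_dimension R (M\<lparr>carrier := Rad R M\<rparr>)"
proof -
  interpret left_module R M by (rule assms(1))
  note lattice = AB5_star_lattice_submodules[OF assms(2)]
  note Rad = submodule_Rad[OF lattice]
  have "\<not> dense_interval {N. submodule N R M} {\<zero>\<^bsub>M\<^esub>} (Rad R M)"
  proof (rule AB5_star_lattice.not_dense_interval_Sup_small[OF lattice])
    show "\<not> dense_interval {N. submodule N R M} {\<zero>\<^bsub>M\<^esub>} S"
      if "AB5_star_lattice.small_over {N. submodule N R M} (carrier M) (set_add M) {\<zero>\<^bsub>M\<^esub>} S" for S
    proof -
      have S: "small_submodule R M S" using that small_submodule_iff[OF lattice] by blast
      then have "submodule S R M" unfolding small_submodule_def by blast
      then show ?thesis using has_krull_dimension_submodule_iff assms(3)[OF S] by blast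
    qed
    show "Rad R M \<in> {N. submodule N R M}" using Rad by simp
    show "Rad R M \<subseteq> Y"
      if "\<And>S. AB5_star_lattice.small_over {N. submodule N R M} (carrier M) (set_add M) {\<zero>\<^bsub>M\<^esub>} S \<Longrightarrow> S \<subseteq> Y" for Y
      unfolding Rad_eq_Union_small[OF lattice] using that small_submodule_iff[OF lattice] by blast
  qed
  then show ?thesis using has_krull_dimension_submodule_iff[OF Rad] by blast
qed

end
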